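(* Let $f:X\to Y$ be a map of multipointed $d$-spaces between two cellular multipointed $d$-spaces $X$ and $Y$. The following are equivalent: (1) $f$ is a globular subdivision, i.e. the underlying continuous map $f:|X|\to|Y|$ is a homeomorphism; (2) the map of directed spaces $\vec{\mathrm{Sp}}(f):\vec{\mathrm{Sp}}(X)\to\vec{\mathrm{Sp}}(Y)$ is an isomorphism.
   Context: $\mathcal{M}(\ell,\ell')$: non-decreasing surjective continuous maps $[0,\ell]\to[0,\ell']$; $\mathcal{I}(1)$: non-decreasing continuous maps $[0,1]\to[0,1]$; $\mu_\ell(t)=t/\ell$. A multipointed $d$-space is $(|X|,X^0,\mathbb{P}^{\mathrm{top}}X)$: a space, a set of states $X^0\subset|X|$, a set of continuous maps $[0,1]\to|X|$ (execution paths) with endpoints in $X^0$, closed under precomposition by $\mathcal{M}(1,1)$ and normalized composition $\gamma_1*_N\gamma_2$ ($\gamma_1(2t)$ on $[0,1/2]$, $\gamma_2(2t-1)$ on $[1/2,1]$); maps are continuous maps preserving states and execution paths. A directed space is $(|Y|,d(Y))$ with $d(Y)$ a set of paths $[0,1]\to|Y|$ containing constants, closed under normalized composition and precomposition by $\mathcal{I}(1)$; morphisms preserve directed paths. $\vec{\mathrm{Sp}}(X)$ is the directed space on $|X|$ whose directed paths are the constant paths and the Moore concatenations $(\gamma_1\phi_1\mu_{\ell_1})*\dots*(\gamma_n\phi_n\mu_{\ell_n})$, $\ell_i>0$, $\sum\ell_i=1$, $\gamma_i$ execution paths, $\phi_i\in\mathcal{I}(1)$; $\vec{\mathrm{Sp}}(f)$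 has the same underlying map as $f$. $\mathrm{Glob}^{\mathrm{top}}(Z)$: quotient of $\{0,1\}\sqcup Z\times[0,1]$ by $(z,0)\sim0$, $(z,1)\sim1$; states $\{0,1\}$; execution paths $\delta_z\phi$, $\delta_z(t)=(z,t)$, $\phi\in\mathcal{M}(1,1)$. A cellular multipointed $d$-space is a colimit $\varinjlim_{\nu<\lambda}X_\nu$ of a colimit-preserving functor on an ordinal $\lambda$ with $X_0=(X^0,X^0,\varnothing)$ for a set $X^0$ and each $X_{\nu+1}$ a pushout of $\mathrm{Glob}^{\mathrm{top}}(\mathbf{S}^{n_\nu-1})\to\mathrm{Glob}^{\mathrm{top}}(\mathbf{D}^{n_\nu})$ (induced by the inclusion of the boundary sphere into the closed disk, $\mathbf{S}^{-1}=\varnothing$, $n_\nu\ge0$) along a map into $X_\nu$. A globular subdivision is a map of multipointed $d$-spaces between cellular multipointed $d$-spaces whose underlying continuous map is a homeomorphism. *)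

theory Defs
  imports "HOL-Analysis.Analysis"
begin

text \<open>A path [0,1] -> S is represented by a function real => 'a that is normalized,
  i.e. constant outside [0,1] (it is determined by its values on [0,1]).\<close>

definition clamp01 :: "real \<Rightarrow> real" where
  "clamp01 t = max 0 (min 1 t)"

definition normal_path :: "(real \<Rightarrow> 'a) \<Rightarrow> bool" where
  "normal_path p \<longleftrightarrow> (\<forall>t. p t = p (clamp01 t))"

definition M11 :: "(real \<Rightarrow> real) set" where
  "M11 = {\<phi>. continuous_on {0..1} \<phi> \<and> mono_on {0..1} \<phi> \<and> \<phi> ` {0..1} = {0..1}}"

definition I1 :: "(real \<Rightarrow> real) set" where
  "I1 = {\<phi>. continuous_on {0..1} \<phi> \<and> mono_on {0..1} \<phi> \<and> \<phi> ` {0..1} \<subseteq> {0..1}}"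

definition reparam :: "(real \<Rightarrow> 'a) \<Rightarrow> (real \<Rightarrow> real) \<Rightarrow> (real \<Rightarrow> 'a)" where
  "reparam p \<phi> = (\<lambda>t. p (\<phi> (clamp01 t)))"

definition ncomp :: "(real \<Rightarrow> 'a) \<Rightarrow> (real \<Rightarrow> 'a) \<Rightarrow> (real \<Rightarrow> 'a)" where
  "ncomp p q = (\<lambda>t. if t \<le> 1/2 then p (2 * t) else q (2 * t - 1))"

record 'a mdspace =
  mtop :: "'a topology"
  mstates :: "'a set"
  mpaths :: "(real \<Rightarrow> 'a) set"

definition is_mdspace :: "'a mdspace \<Rightarrow> bool" where
  "is_mdspace X \<longleftrightarrow>
     mstates X \<subseteq> topspace (mtop X) \<and>
     (\<forall>p\<in>mpaths X. normal_path p \<and> continuous_map (top_of_set {0..1}) (mtop X) p \<and>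
                     p 0 \<in> mstates X \<and> p 1 \<in> mstates X) \<and>
     (\<forall>p\<in>mpaths X. \<forall>\<phi>\<in>M11. reparam p \<phi> \<in> mpaths X) \<and>
     (\<forall>p\<in>mpaths X. \<forall>q\<in>mpaths X. p 1 = q 0 \<longrightarrow> ncomp p q \<in> mpaths X)"

definition mdmap :: "'a mdspace \<Rightarrow> 'b mdspace \<Rightarrow> ('a \<Rightarrow> 'b) \<Rightarrow> bool" where
  "mdmap X Y f \<longleftrightarrow>
     continuous_map (mtop X) (mtop Y) f \<and> f ` mstates X \<subseteq> mstates Y \<and>
     (\<forall>p\<in>mpaths X. f \<circ> p \<in> mpaths Y)"

inductive_set gen_paths :: "(real \<Rightarrow> 'a) set \<Rightarrow> (real \<Rightarrow> 'a) set" for G where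
  base: "p \<in> G \<Longrightarrow> p \<in> gen_paths G"
| rep: "p \<in> gen_paths G \<Longrightarrow> \<phi> \<in> M11 \<Longrightarrow> reparam p \<phi> \<in> gen_paths G"
| comp: "p \<in> gen_paths G \<Longrightarrow> q \<in> gen_paths G \<Longrightarrow> p 1 = q 0 \<Longrightarrow> ncomp p q \<in> gen_paths G"

definition preim :: "'a topology \<Rightarrow> ('a \<Rightarrow> 'b) \<Rightarrow> 'b set \<Rightarrow> 'a set" where
  "preim T g U = {x \<in> topspace T. g x \<in> U}"

text \<open>Pushout square  A --i--> B,  A --a--> C,  C --j--> P,  B --b--> P.
  The colimit is the quotient of |B| + |C| by the equivalence relation generated by
  i(x) ~ a(x), with the final topology, the images of the states, and the execution
  paths generated by the images of the execution paths.\<close>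
definition is_pushout ::
  "'x mdspace \<Rightarrow> 'y mdspace \<Rightarrow> 'z mdspace \<Rightarrow> 'p mdspace \<Rightarrow>
   ('x \<Rightarrow> 'y) \<Rightarrow> ('x \<Rightarrow> 'z) \<Rightarrow> ('z \<Rightarrow> 'p) \<Rightarrow> ('y \<Rightarrow> 'p) \<Rightarrow> bool" where
  "is_pushout A B C P i a j b \<longleftrightarrow>
     is_mdspace A \<and> is_mdspace B \<and> is_mdspace C \<and> is_mdspace P \<and>
     mdmap A B i \<and> mdmap A C a \<and> mdmap C P j \<and> mdmap B P b \<and>
     (\<forall>x\<in>topspace (mtop A). j (a x) = b (i x)) \<and>
     topspace (mtop P) = j ` topspace (mtop C) \<union> b ` topspace (mtop B) \<and>
     (let R = (\<lambda>u v. \<exists>x\<in>topspace (mtop A). u = Inl (i x) \<and> v = Inr (a x)) in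
      \<forall>u\<in>topspace (mtop B) <+> topspace (mtop C). \<forall>v\<in>topspace (mtop B) <+> topspace (mtop C).
        case_sum b j u = case_sum b j v \<longleftrightarrow> (sup R R\<inverse>\<inverse>)\<^sup>*\<^sup>* u v) \<and>
     (\<forall>U. openin (mtop P) U \<longleftrightarrow>
          U \<subseteq> topspace (mtop P) \<and> openin (mtop C) (preim (mtop C) j U) \<and>
          openin (mtop B) (preim (mtop B) b U)) \<and>
     mstates P = j ` mstates C \<union> b ` mstates B \<and>
     mpaths P = gen_paths ((\<lambda>p. j \<circ> p) ` mpaths C \<union> (\<lambda>p. b \<circ> p) ` mpaths B)"

definition is_chain_colim ::
  "('i::linorder) set \<Rightarrow> ('i \<Rightarrow> 'c mdspace) \<Rightarrow> ('i \<Rightarrow> 'i \<Rightarrow> 'c \<Rightarrow> 'c) \<Rightarrow>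
   'p mdspace \<Rightarrow> ('i \<Rightarrow> 'c \<Rightarrow> 'p) \<Rightarrow> bool" where
  "is_chain_colim K D t P c \<longleftrightarrow>
     is_mdspace P \<and>
     (\<forall>k\<in>K. mdmap (D k) P (c k)) \<and>
     (\<forall>k\<in>K. \<forall>m\<in>K. k \<le> m \<longrightarrow> (\<forall>x\<in>topspace (mtop (D k)). c m (t k m x) = c k x)) \<and>
     topspace (mtop P) = (\<Union>k\<in>K. c k ` topspace (mtop (D k))) \<and>
     (let R = (\<lambda>(k, x) (m, y). k \<in> K \<and> m \<in> K \<and> k \<le> m \<and> x \<in> topspace (mtop (D k)) \<and> y = t k m x) in
      \<forall>k\<in>K. \<forall>m\<in>K. \<forall>x\<in>topspace (mtop (D k)). \<forall>y\<in>topspace (mtop (D m)).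
        c k x = c m y \<longleftrightarrow> (sup R R\<inverse>\<inverse>)\<^sup>*\<^sup>* (k, x) (m, y)) \<and>
     (\<forall>U. openin (mtop P) U \<longleftrightarrow>
          U \<subseteq> topspace (mtop P) \<and> (\<forall>k\<in>K. openin (mtop (D k)) (preim (mtop (D k)) (c k) U))) \<and>
     mstates P = (\<Union>k\<in>K. c k ` mstates (D k)) \<and>
     mpaths P = gen_paths (\<Union>k\<in>K. (\<lambda>p. c k \<circ> p) ` mpaths (D k))"

datatype 'z gpt = G0 | G1 | GM 'z real

text \<open>Image of (z,t) in Glob(Z) = ({0,1} + Z x [0,1]) / ((z,0) ~ 0, (z,1) ~ 1).\<close>
definition gq :: "'z \<Rightarrow> real \<Rightarrow> 'z gpt" where
  "gq z t = (if t \<le> 0 then G0 else if 1 \<le> t then G1 else GM z t)"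

definition glob_carrier :: "'z topology \<Rightarrow> 'z gpt set" where
  "glob_carrier Z = {G0, G1} \<union> {GM z t | z t. z \<in> topspace Z \<and> 0 < t \<and> t < 1}"

text \<open>Quotient topology (the summand {0,1} is discrete and imposes no condition).\<close>
definition glob_open :: "'z topology \<Rightarrow> 'z gpt set \<Rightarrow> bool" where
  "glob_open Z U \<longleftrightarrow> U \<subseteq> glob_carrier Z \<and>
     openin (prod_topology Z (top_of_set {0..1}))
       {w \<in> topspace (prod_topology Z (top_of_set {0..1})). gq (fst w) (snd w) \<in> U}"

lemma istopology_glob_open: "istopology (glob_open Z)"
  unfolding istopology_def glob_open_def
proof (intro conjI allI impI)
  fix S T assume S: "S \<subseteq> glob_carrier Z \<and> openin (prod_topology Z (top_of_set {0..1}))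
       {w \<in> topspace (prod_topology Z (top_of_set {0..1})). gq (fst w) (snd w) \<in> S}"
    and T: "T \<subseteq> glob_carrier Z \<and> openin (prod_topology Z (top_of_set {0..1}))
       {w \<in> topspace (prod_topology Z (top_of_set {0..1})). gq (fst w) (snd w) \<in> T}"
  have eq: "{w \<in> topspace (prod_topology Z (top_of_set {0..1})). gq (fst w) (snd w) \<in> S \<inter> T}
      = {w \<in> topspace (prod_topology Z (top_of_set {0..1})). gq (fst w) (snd w) \<in> S}
        \<inter> {w \<in> topspace (prod_topology Z (top_of_set {0..1})). gq (fst w) (snd w) \<in> T}" by blast
  show "S \<inter> T \<subseteq> glob_carrier Z" using S by blast
  show "openin (prod_topology Z (top_of_set {0..1}))
       {w \<in> topspace (prod_topology Z (top_of_set {0..1})). gq (fst w) (snd w) \<in> S \<inter> T}"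
    unfolding eq using S T by (intro openin_Int) auto
next
  fix K assume K: "\<forall>U\<in>K. U \<subseteq> glob_carrier Z \<and> openin (prod_topology Z (top_of_set {0..1}))
       {w \<in> topspace (prod_topology Z (top_of_set {0..1})). gq (fst w) (snd w) \<in> U}"
  have eq: "{w \<in> topspace (prod_topology Z (top_of_set {0..1})). gq (fst w) (snd w) \<in> \<Union>K}
      = \<Union>((\<lambda>U. {w \<in> topspace (prod_topology Z (top_of_set {0..1})). gq (fst w) (snd w) \<in> U}) ` K)"
    by blast
  show "\<Union>K \<subseteq> glob_carrier Z" using K by blast
  show "openin (prod_topology Z (top_of_set {0..1}))
       {w \<in> topspace (prod_topology Z (top_of_set {0..1})). gq (fst w) (snd w) \<in> \<Union>K}"
    unfolding eq using K by (intro openin_Union) auto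
qed

definition glob :: "'z topology \<Rightarrow> 'z gpt mdspace" where
  "glob Z = \<lparr> mtop = topology (glob_open Z), mstates = {G0, G1},
              mpaths = {(\<lambda>t. gq z (\<phi> (clamp01 t))) | z \<phi>. z \<in> topspace Z \<and> \<phi> \<in> M11} \<rparr>"

text \<open>Closed disk D^n and sphere S^(n-1), as subsets of R^n embedded in nat => real
  (coordinates >= n vanish); the product topology on nat => real restricts to the
  euclidean topology. S^(-1) is empty.\<close>
definition disk :: "nat \<Rightarrow> (nat \<Rightarrow> real) set" where
  "disk n = {x. (\<forall>i\<ge>n. x i = 0) \<and> (\<Sum>i<n. (x i)\<^sup>2) \<le> 1}"

definition sphere_bd :: "nat \<Rightarrow> (nat \<Rightarrow> real) set" where
  "sphere_bd n = {x. (\<forall>i\<ge>n. x i = 0) \<and> (\<Sum>i<n. (x i)\<^sup>2) = 1}"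

definition is_succ :: "'i::wellorder \<Rightarrow> 'i \<Rightarrow> bool" where
  "is_succ \<nu> s \<longleftrightarrow> \<nu> < s \<and> (\<forall>m. \<nu> < m \<longrightarrow> s \<le> m)"

definition is_limit :: "'i::wellorder \<Rightarrow> bool" where
  "is_limit \<nu> \<longleftrightarrow> (\<exists>\<mu>. \<mu> < \<nu>) \<and> \<not> (\<exists>\<mu>. is_succ \<mu> \<nu>)"

text \<open>A cellular presentation of X: a tower (D \<nu>)_{\<nu> < \<lambda>} indexed by a well-ordered type
  (of order type \<lambda>), with transition maps t \<mu> \<nu>, and a colimit cocone c into X.\<close>
definition cellular_pres ::
  "('i::wellorder \<Rightarrow> 'c mdspace) \<Rightarrow> ('i \<Rightarrow> 'i \<Rightarrow> 'c \<Rightarrow> 'c) \<Rightarrow> ('i \<Rightarrow> 'c \<Rightarrow> 'a) \<Rightarrow> 'a mdspace \<Rightarrow> bool" where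
  "cellular_pres D t c X \<longleftrightarrow>
     (\<forall>k. is_mdspace (D k)) \<and>
     (\<forall>k m. k \<le> m \<longrightarrow> mdmap (D k) (D m) (t k m)) \<and>
     (\<forall>k. \<forall>x\<in>topspace (mtop (D k)). t k k x = x) \<and>
     (\<forall>k m r. k \<le> m \<longrightarrow> m \<le> r \<longrightarrow> (\<forall>x\<in>topspace (mtop (D k)). t m r (t k m x) = t k r x)) \<and>
     (\<exists>S. D (LEAST k. True) = \<lparr> mtop = discrete_topology S, mstates = S, mpaths = {} \<rparr>) \<and>
     (\<forall>\<nu> s. is_succ \<nu> s \<longrightarrow>
        (\<exists>n a b. is_pushout (glob (top_of_set (sphere_bd n))) (glob (top_of_set (disk n)))
                   (D \<nu>) (D s) id a (t \<nu> s) b)) \<and>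
     (\<forall>\<nu>. is_limit \<nu> \<longrightarrow> is_chain_colim {\<mu>. \<mu> < \<nu>} D t (D \<nu>) (\<lambda>\<mu>. t \<mu> \<nu>)) \<and>
     is_chain_colim UNIV D t X c"

record 'a dspace =
  dtop :: "'a topology"
  dpaths :: "(real \<Rightarrow> 'a) set"

definition is_dspace :: "'a dspace \<Rightarrow> bool" where
  "is_dspace Y \<longleftrightarrow>
     (\<forall>p\<in>dpaths Y. normal_path p \<and> continuous_map (top_of_set {0..1}) (dtop Y) p) \<and>
     (\<forall>x\<in>topspace (dtop Y). (\<lambda>t. x) \<in> dpaths Y) \<and>
     (\<forall>p\<in>dpaths Y. \<forall>q\<in>dpaths Y. p 1 = q 0 \<longrightarrow> ncomp p q \<in> dpaths Y) \<and>
     (\<forall>p\<in>dpaths Y. \<forall>\<phi>\<in>I1. reparam p \<phi> \<in> dpaths Y)"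

definition dmap :: "'a dspace \<Rightarrow> 'b dspace \<Rightarrow> ('a \<Rightarrow> 'b) \<Rightarrow> bool" where
  "dmap X Y f \<longleftrightarrow> continuous_map (dtop X) (dtop Y) f \<and> (\<forall>p\<in>dpaths X. f \<circ> p \<in> dpaths Y)"

definition dspace_iso :: "'a dspace \<Rightarrow> 'b dspace \<Rightarrow> ('a \<Rightarrow> 'b) \<Rightarrow> bool" where
  "dspace_iso X Y f \<longleftrightarrow> dmap X Y f \<and>
     (\<exists>g. dmap Y X g \<and> (\<forall>x\<in>topspace (dtop X). g (f x) = x) \<and> (\<forall>y\<in>topspace (dtop Y). f (g y) = y))"

text \<open>Moore concatenation (g_0 phi_0 mu_{l_0}) * ... * (g_{n-1} phi_{n-1} mu_{l_{n-1}}),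
  a path [0,1] -> |X| equal on [L_i, L_{i+1}] (L_i = l_0 + ... + l_{i-1}) to
  t |-> g_i (phi_i ((t - L_i) / l_i)).\<close>
definition moore_concat_path :: "'a mdspace \<Rightarrow> (real \<Rightarrow> 'a) \<Rightarrow> bool" where
  "moore_concat_path X p \<longleftrightarrow>
     (\<exists>n \<gamma> \<phi> len. n \<ge> 1 \<and>
        (\<forall>i<n. 0 < len i \<and> \<gamma> i \<in> mpaths X \<and> \<phi> i \<in> I1) \<and>
        (\<Sum>i<n. len i) = 1 \<and>
        (\<forall>i<n. \<forall>t. (\<Sum>j<i. len j) \<le> t \<and> t \<le> (\<Sum>j<Suc i. len j) \<longrightarrow>
              p t = \<gamma> i (\<phi> i ((t - (\<Sum>j<i. len j)) / len i))))"

definition Sp :: "'a mdspace \<Rightarrow> 'a dspace" where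
  "Sp X = \<lparr> dtop = mtop X,
            dpaths = {p. normal_path p \<and>
                         ((\<exists>x\<in>topspace (mtop X). p = (\<lambda>t. x)) \<or> moore_concat_path X p)} \<rparr>"

end

theory Submission
  imports Defs
begin

text \<open>
  The points of a cellular multipointed d-space that are not states are partitioned by the
  open-cell paths \<open>t \<mapsto> (z, t)\<close>, \<open>0 < t < 1\<close>, with \<open>z\<close> in the interior of the disk of a
  globular cell, and every execution path is a finite concatenation of such paths up to
  surjective reparametrization. Let \<open>f\<close> be a homeomorphism with inverse \<open>g\<close> and let \<open>\<delta>\<close> be an
  open-cell path of \<open>Y\<close>. The point \<open>g (\<delta> (1/2))\<close> is not a state of \<open>X\<close>, so it lies on an
  open-cell path \<open>\<delta>'\<close> of \<open>X\<close>. The execution path \<open>f \<circ> \<delta>'\<close> of \<open>Y\<close> meets \<open>\<delta>\<close> at an interior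
  point, so by the partition property it contains a full reparametrized copy of \<open>\<delta>\<close>; the
  reparametrization is strictly increasing because \<open>f \<circ> \<delta>'\<close> is injective on the open interval.
  Inverting it exhibits \<open>g \<circ> \<delta>\<close> as a reparametrized part of \<open>\<delta>'\<close>, hence as a directed path.
\<close>

section \<open>Piecewise decompositions of paths\<close>

text \<open>The path stays fixed while cut points are added on the right, so appending a piece needs
  no rescaling of the earlier ones.\<close>

inductive pieces :: "(real \<Rightarrow> real \<Rightarrow> (real \<Rightarrow> 'a) \<Rightarrow> bool) \<Rightarrow> real \<Rightarrow> real \<Rightarrow> (real \<Rightarrow> 'a) \<Rightarrow> bool"
  for B where
  single: "B a b p \<Longrightarrow> pieces B a b p"
| snoc: "pieces B a b p \<Longrightarrow> B b c p \<Longrightarrow> pieces B a c p"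

lemma pieces_trans:
  assumes "pieces B b c p" and "pieces B a b p"
  shows "pieces B a c p"
  using assms by induction (auto intro: pieces.intros)

lemma pieces_less:
  assumes "pieces B a b p" and "\<And>a b p. B a b p \<Longrightarrow> a < b"
  shows "a < b"
  using assms(1)
proof induction
  case (single a b p)
  then show ?case by (rule assms(2))
next
  case (snoc a b p c)
  then show ?case using assms(2)[of b c p] by linarith
qed

text \<open>Used to single out the piece of a decomposition that passes through a prescribed cell
  point.\<close>

lemma pieces_locate:
  assumes "pieces B a b p" and "\<And>a b p. B a b p \<Longrightarrow> a < b" and "s \<in> {a..b}"
  shows "\<exists>a' b'. a \<le> a' \<and> s \<in> {a'..b'} \<and> b' \<le> b \<and> B a' b' p"
  using assms(1,3)
proof induction
  case (single a b p)
  then show ?case by auto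
next
  case (snoc a b p c)
  have "b < c" using snoc.hyps assms(2) by blast
  have "a < b" using pieces_less[OF snoc.hyps(1) assms(2)] .
  show ?case
  proof (cases "s \<le> b")
    case True
    then obtain a' b' where "a \<le> a'" "s \<in> {a'..b'}" "b' \<le> b" "B a' b' p"
      using snoc by auto
    then show ?thesis using \<open>b < c\<close> by (intro exI[of _ a'] exI[of _ b']) auto
  next
    case False
    then show ?thesis using snoc.hyps(2) snoc.prems \<open>a < b\<close> by (intro exI[of _ b] exI[of _ c]) auto
  qed
qed

text \<open>A factor of a Moore concatenation, with the affine rescaling absorbed into
  \<open>\<phi>\<close>.\<close>

definition directed_piece :: "(real \<Rightarrow> 'a) set \<Rightarrow> real \<Rightarrow> real \<Rightarrow> (real \<Rightarrow> 'a) \<Rightarrow> bool" where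
  "directed_piece G a b p \<longleftrightarrow> a < b \<and>
     (\<exists>\<gamma>\<in>G. \<exists>\<phi>. continuous_on {a..b} \<phi> \<and> mono_on {a..b} \<phi> \<and> \<phi> ` {a..b} \<subseteq> {0..1} \<and>
        (\<forall>r\<in>{a..b}. p r = \<gamma> (\<phi> r)))"

text \<open>The endpoint values make \<open>\<phi>\<close> surjective onto the unit interval by the
  intermediate value theorem, so \<open>\<gamma>\<close> is traversed entirely. This lets a single
  interior meeting point capture a whole cell path.\<close>

definition full_piece :: "(real \<Rightarrow> 'a) set \<Rightarrow> real \<Rightarrow> real \<Rightarrow> (real \<Rightarrow> 'a) \<Rightarrow> bool" where
  "full_piece G a b p \<longleftrightarrow> a < b \<and>
     (\<exists>\<gamma>\<in>G. \<exists>\<phi>. continuous_on {a..b} \<phi> \<and> mono_on {a..b} \<phi> \<and> \<phi> a = 0 \<and> \<phi> b = 1 \<and>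
        (\<forall>r\<in>{a..b}. p r = \<gamma> (\<phi> r)))"

lemma directed_piece_less: "directed_piece G a b p \<Longrightarrow> a < b"
  by (simp add: directed_piece_def)

lemma full_piece_less: "full_piece G a b p \<Longrightarrow> a < b"
  by (simp add: full_piece_def)

lemma directed_pieces_less: "pieces (directed_piece G) a b p \<Longrightarrow> a < b"
  by (erule pieces_less) (rule directed_piece_less)

lemma full_pieces_less: "pieces (full_piece G) a b p \<Longrightarrow> a < b"
  by (erule pieces_less) (rule full_piece_less)

lemma mono_on_image_interval:
  fixes \<phi> :: "real \<Rightarrow> real"
  assumes "mono_on {a..b} \<phi>"
  shows "\<phi> ` {a..b} \<subseteq> {\<phi> a..\<phi> b}"
proof
  fix y assume "y \<in> \<phi> ` {a..b}"
  then obtain x where x: "x \<in> {a..b}" "y = \<phi> x" by blast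
  have "\<phi> a \<le> \<phi> x" "\<phi> x \<le> \<phi> b"
    using x by (auto intro!: mono_onD[OF assms])
  then show "y \<in> {\<phi> a..\<phi> b}" using x by auto
qed

lemma directed_piece_reparam:
  assumes "directed_piece G a b p" and "c < d" and "continuous_on {c..d} \<psi>"
    and "mono_on {c..d} \<psi>" and "\<psi> ` {c..d} \<subseteq> {a..b}"
  shows "directed_piece G c d (p \<circ> \<psi>)"
proof -
  obtain \<gamma> \<phi> where \<gamma>: "\<gamma> \<in> G" and \<phi>: "continuous_on {a..b} \<phi>" "mono_on {a..b} \<phi>"
      "\<phi> ` {a..b} \<subseteq> {0..1}" "\<forall>r\<in>{a..b}. p r = \<gamma> (\<phi> r)"
    using assms(1) unfolding directed_piece_def by blast
  have "continuous_on {c..d} (\<phi> \<circ> \<psi>)"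
    using assms(3,5) \<phi>(1) continuous_on_compose continuous_on_subset by blast
  moreover have "mono_on {c..d} (\<phi> \<circ> \<psi>)"
    unfolding comp_def
    using assms(4,5) \<phi>(2) by (intro mono_onI) (auto simp: mono_on_def image_subset_iff)
  moreover have "(\<phi> \<circ> \<psi>) ` {c..d} \<subseteq> {0..1}"
    using assms(5) \<phi>(3) by (fastforce simp: image_subset_iff)
  moreover have "\<forall>r\<in>{c..d}. (p \<circ> \<psi>) r = \<gamma> ((\<phi> \<circ> \<psi>) r)"
    using assms(5) \<phi>(4) by auto
  ultimately show ?thesis
    unfolding directed_piece_def using \<gamma> assms(2) by blast
qed

lemma full_piece_reparam:
  assumes "full_piece G a b p" and "c < d" and "continuous_on {c..d} \<psi>"
    and "mono_on {c..d} \<psi>" and "\<psi> c = a" and "\<psi> d = b"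
  shows "full_piece G c d (p \<circ> \<psi>)"
proof -
  obtain \<gamma> \<phi> where \<gamma>: "\<gamma> \<in> G" and \<phi>: "continuous_on {a..b} \<phi>" "mono_on {a..b} \<phi>"
      "\<phi> a = 0" "\<phi> b = 1" "\<forall>r\<in>{a..b}. p r = \<gamma> (\<phi> r)"
    using assms(1) unfolding full_piece_def by blast
  have im: "\<psi> ` {c..d} \<subseteq> {a..b}"
    using mono_on_image_interval[OF assms(4)] assms(5,6) by simp
  have "continuous_on {c..d} (\<phi> \<circ> \<psi>)"
    using assms(3) im \<phi>(1) continuous_on_compose continuous_on_subset by blast
  moreover have "mono_on {c..d} (\<phi> \<circ> \<psi>)"
    unfolding comp_def
    using assms(4) im \<phi>(2) by (intro mono_onI) (auto simp: mono_on_def image_subset_iff)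
  moreover have "(\<phi> \<circ> \<psi>) c = 0" "(\<phi> \<circ> \<psi>) d = 1"
    using assms(5,6) \<phi>(3,4) by auto
  moreover have "\<forall>r\<in>{c..d}. (p \<circ> \<psi>) r = \<gamma> ((\<phi> \<circ> \<psi>) r)"
    using im \<phi>(5) by auto
  ultimately show ?thesis
    unfolding full_piece_def using \<gamma> assms(2) by blast
qed

text \<open>Induction on the decomposition. If \<open>\<psi>\<close> takes values strictly on both
  sides of the last cut, the interval is split at a preimage of that cut; otherwise the image lies
  on one side. The domain is kept arbitrary because the induction hypothesis may be needed on a
  shorter interval.\<close>

lemma directed_pieces_reparam:
  assumes "pieces (directed_piece G) a b p" and "c < d" and "continuous_on {c..d} \<psi>"
    and "mono_on {c..d} \<psi>" and "\<psi> ` {c..d} \<subseteq> {a..b}"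
  shows "pieces (directed_piece G) c d (p \<circ> \<psi>)"
  using assms
proof (induction arbitrary: c d)
  case (single a b p)
  then show ?case by (intro pieces.single directed_piece_reparam)
next
  case (snoc a b p e)
  have "c \<in> {c..d}" "d \<in> {c..d}" using snoc.prems(1) by auto
  then have ends: "a \<le> \<psi> c" "\<psi> d \<le> e" using snoc.prems(4) by (auto simp: image_subset_iff)
  note img = mono_on_image_interval[OF snoc.prems(3)]
  consider "\<psi> d \<le> b" | "b \<le> \<psi> c" | "\<psi> c < b" "b < \<psi> d" by linarith
  then show ?case
  proof cases
    case 1
    have "\<psi> ` {c..d} \<subseteq> {a..b}" using img ends 1 by fastforce
    then show ?thesis using snoc by blast
  next
    case 2
    have "\<psi> ` {c..d} \<subseteq> {b..e}" using img ends 2 by fastforce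
    then show ?thesis using snoc.prems
      by (intro pieces.single directed_piece_reparam[OF snoc.hyps(2)])
  next
    case 3
    obtain m where m: "c \<le> m" "m \<le> d" "\<psi> m = b"
      using IVT'[of \<psi> c b d] 3 snoc.prems by auto
    then have "c < m" "m < d" using 3 by (auto simp: less_le)
    have "{c..m} \<subseteq> {c..d}" "{m..d} \<subseteq> {c..d}" using m by auto
    then have cont: "continuous_on {c..m} \<psi>" "continuous_on {m..d} \<psi>"
      and mono: "mono_on {c..m} \<psi>" "mono_on {m..d} \<psi>"
      using snoc.prems continuous_on_subset mono_on_subset by blast+
    have "\<psi> ` {c..m} \<subseteq> {a..b}" "\<psi> ` {m..d} \<subseteq> {b..e}"
      using mono_on_image_interval[OF mono(1)] mono_on_image_interval[OF mono(2)] ends m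
      by fastforce+
    then have "pieces (directed_piece G) c m (p \<circ> \<psi>)" "directed_piece G m d (p \<circ> \<psi>)"
      using snoc.IH[OF \<open>c < m\<close> cont(1) mono(1)]
        directed_piece_reparam[OF snoc.hyps(2) \<open>m < d\<close> cont(2) mono(2)] by blast+
    then show ?thesis by (rule pieces.snoc)
  qed
qed

text \<open>Since \<open>\<psi>\<close> joins the two extreme end points, it attains every cut, and
  preimages of the old cuts serve as new ones.\<close>

lemma full_pieces_reparam:
  assumes "pieces (full_piece G) a b p" and "c < d" and "continuous_on {c..d} \<psi>"
    and "mono_on {c..d} \<psi>" and "\<psi> c = a" and "\<psi> d = b"
  shows "pieces (full_piece G) c d (p \<circ> \<psi>)"
  using assms
proof (induction arbitrary: c d)
  case (single a b p)
  then show ?case by (intro pieces.single full_piece_reparam)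
next
  case (snoc a b p e)
  have "a < b" "b < e"
    using full_pieces_less[OF snoc.hyps(1)] full_piece_less[OF snoc.hyps(2)] .
  then obtain m where m: "c \<le> m" "m \<le> d" "\<psi> m = b"
    using IVT'[of \<psi> c b d] snoc.prems by auto
  then have "c < m" "m < d" using \<open>a < b\<close> \<open>b < e\<close> snoc.prems by (auto simp: less_le)
  have "{c..m} \<subseteq> {c..d}" "{m..d} \<subseteq> {c..d}" using m by auto
  then have cont: "continuous_on {c..m} \<psi>" "continuous_on {m..d} \<psi>"
    and mono: "mono_on {c..m} \<psi>" "mono_on {m..d} \<psi>"
    using snoc.prems continuous_on_subset mono_on_subset by blast+
  have "pieces (full_piece G) c m (p \<circ> \<psi>)" "full_piece G m d (p \<circ> \<psi>)"
    using snoc.IH[of c m] snoc.prems \<open>c < m\<close> \<open>m < d\<close> cont mono m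
      full_piece_reparam[OF snoc.hyps(2), of m d \<psi>] by blast+
  then show ?case by (rule pieces.snoc)
qed

lemma directed_pieces_cong:
  assumes "pieces (directed_piece G) a b p" and "\<And>r. r \<in> {a..b} \<Longrightarrow> p r = q r"
  shows "pieces (directed_piece G) a b q"
  using assms
proof induction
  case (single a b p)
  then show ?case by (intro pieces.single) (simp add: directed_piece_def)
next
  case (snoc a b p c)
  have "a < b" "b < c"
    using directed_pieces_less[OF snoc.hyps(1)] directed_piece_less[OF snoc.hyps(2)] .
  then have "directed_piece G b c q" using snoc by (simp add: directed_piece_def)
  moreover have "pieces (directed_piece G) a b q" using snoc \<open>b < c\<close> by simp
  ultimately show ?case using pieces.snoc by blast
qed

lemma full_pieces_cong:
  assumes "pieces (full_piece G) a b p" and "\<And>r. r \<in> {a..b} \<Longrightarrow> p r = q r"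
  shows "pieces (full_piece G) a b q"
  using assms
proof induction
  case (single a b p)
  then show ?case by (intro pieces.single) (simp add: full_piece_def)
next
  case (snoc a b p c)
  have "a < b" "b < c"
    using full_pieces_less[OF snoc.hyps(1)] full_piece_less[OF snoc.hyps(2)] .
  then have "full_piece G b c q" using snoc by (simp add: full_piece_def)
  moreover have "pieces (full_piece G) a b q" using snoc \<open>b < c\<close> by simp
  ultimately show ?case using pieces.snoc by blast
qed

section \<open>Moore concatenations as finite decompositions\<close>

lemma moore_concat_path_imp_pieces:
  assumes "moore_concat_path X p"
  shows "pieces (directed_piece (mpaths X)) 0 1 p"
proof -
  obtain n \<gamma> \<phi> len where n: "n \<ge> 1"
    and gen: "\<And>i. i < n \<Longrightarrow> 0 < len i \<and> \<gamma> i \<in> mpaths X \<and> \<phi> i \<in> I1"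
    and total: "(\<Sum>i<n. len i) = (1::real)"
    and p: "\<And>i t. i < n \<Longrightarrow> (\<Sum>j<i. len j) \<le> t \<Longrightarrow> t \<le> (\<Sum>j<Suc i. len j) \<Longrightarrow>
              p t = \<gamma> i (\<phi> i ((t - (\<Sum>j<i. len j)) / len i))"
    using assms unfolding moore_concat_path_def by blast
  define L where "L i = (\<Sum>j<i. len j)" for i
  have piece: "directed_piece (mpaths X) (L i) (L (Suc i)) p" if i: "i < n" for i
  proof -
    have len: "0 < len i" and L: "L (Suc i) = L i + len i" using gen[OF i] by (auto simp: L_def)
    let ?\<mu> = "\<lambda>t. (t - L i) / len i"
    have im: "?\<mu> ` {L i..L (Suc i)} \<subseteq> {0..1}" using len by (auto simp: L divide_simps)
    have \<phi>: "continuous_on {0..1} (\<phi> i)" "mono_on {0..1} (\<phi> i)" "\<phi> i ` {0..1} \<subseteq> {0..1}"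
      using gen[OF i] by (auto simp: I1_def)
    have "directed_piece (mpaths X) 0 1 (\<gamma> i \<circ> \<phi> i)"
      unfolding directed_piece_def using \<phi> gen[OF i] by auto
    then have "directed_piece (mpaths X) (L i) (L (Suc i)) ((\<gamma> i \<circ> \<phi> i) \<circ> ?\<mu>)"
      using len im
      by (elim directed_piece_reparam)
        (auto simp: L intro!: continuous_intros mono_onI divide_right_mono)
    moreover have "p r = ((\<gamma> i \<circ> \<phi> i) \<circ> ?\<mu>) r" if "r \<in> {L i..L (Suc i)}" for r
      using p[OF i, of r] that by (simp add: L_def)
    ultimately show ?thesis by (simp add: directed_piece_def)
  qed
  have "pieces (directed_piece (mpaths X)) 0 (L (Suc i)) p" if "i < n" for i
    using that
  proof (induction i)
    case 0
    then show ?case using piece[of 0] by (intro pieces.single) (simp add: L_def)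
  next
    case (Suc i)
    then have "pieces (directed_piece (mpaths X)) 0 (L (Suc i)) p" by simp
    then show ?case using piece[OF Suc.prems] by (rule pieces.snoc)
  qed
  \<comment> \<open>The last index is \<open>n - 1\<close>, whose right end \<open>L n\<close> is
    the total length 1.\<close>
  from this[of "n - 1"] n show ?thesis by (simp add: total L_def)
qed

text \<open>General end points let the induction run: the lengths need only add up to
  \<open>b - a\<close>, and a new last piece leaves the earlier partial sums from \<open>a\<close>
  untouched.\<close>

lemma pieces_imp_moore_shifted:
  assumes "pieces (directed_piece G) a b p"
  shows "\<exists>n \<gamma> \<phi> len. n \<ge> 1 \<and>
        (\<forall>i<n. 0 < len i \<and> \<gamma> i \<in> G \<and> \<phi> i \<in> I1) \<and>
        a + (\<Sum>i<n. len i) = b \<and>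
        (\<forall>i<n. \<forall>t. a + (\<Sum>j<i. len j) \<le> t \<and> t \<le> a + (\<Sum>j<Suc i. len j) \<longrightarrow>
              p t = \<gamma> i (\<phi> i ((t - (a + (\<Sum>j<i. len j))) / len i)))"
  using assms
proof induction
  \<comment> \<open>Both cases of the induction normalize a piece to a map in \<open>I1\<close> by
    precomposing with the affine map from \<open>{0..1}\<close> onto \<open>{a..b}\<close>.\<close>
  have unit: "\<exists>\<gamma> \<phi>. \<gamma> \<in> G \<and> \<phi> \<in> I1 \<and> (\<forall>r\<in>{a..b}. p r = \<gamma> (\<phi> ((r - a) / (b - a))))"
    if B: "directed_piece G a b p" for a b and p :: "real \<Rightarrow> 'a"
  proof -
    obtain \<gamma> \<phi> where \<gamma>: "\<gamma> \<in> G" and ab: "a < b"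
      and \<phi>: "continuous_on {a..b} \<phi>" "mono_on {a..b} \<phi>" "\<phi> ` {a..b} \<subseteq> {0..1}"
        "\<forall>r\<in>{a..b}. p r = \<gamma> (\<phi> r)"
      using B unfolding directed_piece_def by blast
    let ?\<nu> = "\<lambda>t. a + t * (b - a)"
    have im: "?\<nu> ` {0..1} \<subseteq> {a..b}"
    proof (clarsimp, intro conjI)
      fix x :: real assume "0 \<le> x" "x \<le> 1"
      then show "0 \<le> x * (b - a)" using ab by simp
      have "x * (b - a) \<le> 1 * (b - a)" using \<open>x \<le> 1\<close> ab by (intro mult_right_mono) auto
      then show "a + x * (b - a) \<le> b" by simp
    qed
    have "continuous_on {0..1} (\<phi> \<circ> ?\<nu>)"
      using im \<phi>(1) by (intro continuous_on_compose continuous_intros) (auto intro: continuous_on_subset)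
    moreover have "mono_on {0..1} (\<phi> \<circ> ?\<nu>)"
    proof (rule mono_onI)
      fix r s :: real assume rs: "r \<in> {0..1}" "s \<in> {0..1}" "r \<le> s"
      have "?\<nu> r \<in> {a..b}" "?\<nu> s \<in> {a..b}" using im rs by blast+
      moreover have "?\<nu> r \<le> ?\<nu> s" using rs ab by (simp add: mult_right_mono)
      ultimately show "(\<phi> \<circ> ?\<nu>) r \<le> (\<phi> \<circ> ?\<nu>) s"
        unfolding comp_def by (rule mono_onD[OF \<phi>(2)])
    qed
    moreover have "(\<phi> \<circ> ?\<nu>) ` {0..1} \<subseteq> {0..1}"
      unfolding image_comp[symmetric] using im \<phi>(3) by blast
    moreover have "\<forall>r\<in>{a..b}. p r = \<gamma> ((\<phi> \<circ> ?\<nu>) ((r - a) / (b - a)))"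
      using \<phi>(4) ab by simp
    ultimately show ?thesis using \<gamma> unfolding I1_def by blast
  qed
  {
    case (single a b p)
    then obtain \<gamma> \<phi> where "\<gamma> \<in> G" "\<phi> \<in> I1" "\<forall>r\<in>{a..b}. p r = \<gamma> (\<phi> ((r - a) / (b - a)))"
      using unit by blast
    moreover have "a < b" using single directed_piece_less by blast
    ultimately show ?case
      by (intro exI[of _ 1] exI[of _ "\<lambda>_. \<gamma>"] exI[of _ "\<lambda>_. \<phi>"] exI[of _ "\<lambda>_. b - a"]) auto
  next
    case (snoc a b p c)
    then obtain n \<gamma> \<phi> len where n: "n \<ge> 1"
      and gen: "\<And>i. i < n \<Longrightarrow> 0 < len i \<and> \<gamma> i \<in> G \<and> \<phi> i \<in> I1"
      and total: "a + (\<Sum>i<n. len i) = b"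
      and p: "\<And>i t. i < n \<Longrightarrow> a + (\<Sum>j<i. len j) \<le> t \<Longrightarrow> t \<le> a + (\<Sum>j<Suc i. len j) \<Longrightarrow>
              p t = \<gamma> i (\<phi> i ((t - (a + (\<Sum>j<i. len j))) / len i))"
      by blast
    obtain \<gamma>' \<phi>' where new: "\<gamma>' \<in> G" "\<phi>' \<in> I1"
        "\<forall>r\<in>{b..c}. p r = \<gamma>' (\<phi>' ((r - b) / (c - b)))"
      using unit snoc.hyps(2) by blast
    have "b < c" using snoc.hyps(2) directed_piece_less by blast
    define len' where "len' = len(n := c - b)"
    \<comment> \<open>The update is at index \<open>n\<close>, which a sum over \<open>j < i\<close>
      with \<open>i \<le> n\<close> never reaches.\<close>
    have sums: "(\<Sum>j<i. len' j) = (\<Sum>j<i. len j)" if "i \<le> n" for i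
      using that by (intro sum.cong) (auto simp: len'_def)
    show ?case
    proof (intro exI[of _ "Suc n"] exI[of _ "\<gamma>(n := \<gamma>')"] exI[of _ "\<phi>(n := \<phi>')"] exI[of _ len'] conjI allI impI)
      show "1 \<le> Suc n" by simp
      fix i assume i: "i < Suc n"
      show "0 < len' i" "(\<gamma>(n := \<gamma>')) i \<in> G" "(\<phi>(n := \<phi>')) i \<in> I1"
        using i gen[of i] new \<open>b < c\<close> by (auto simp: len'_def less_Suc_eq)
      fix t assume t: "a + sum len' {..<i} \<le> t \<and> t \<le> a + sum len' {..<Suc i}"
      show "p t = (\<gamma>(n := \<gamma>')) i ((\<phi>(n := \<phi>')) i ((t - (a + sum len' {..<i})) / len' i))"
      proof (cases "i = n")
        case True
        have "sum len' {..<Suc n} = sum len {..<n} + (c - b)"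
          using sums[of n] by (simp add: len'_def)
        then show ?thesis using t new True total sums[of n] by (auto simp: len'_def)
      next
        case False
        then have "i < n" using i by simp
        then show ?thesis using t p[of i t] sums[of i] sums[of "Suc i"] False
          by (simp add: len'_def)
      qed
    next
      show "a + sum len' {..<Suc n} = c"
        using sums[of n] total by (simp add: len'_def)
    qed
  }
qed

lemma pieces_imp_moore_concat_path:
  assumes "pieces (directed_piece (mpaths X)) 0 1 p"
  shows "moore_concat_path X p"
  using pieces_imp_moore_shifted[OF assms] unfolding moore_concat_path_def by simp

section \<open>Decomposing generated execution paths\<close>

lemma M11_ends:
  assumes "\<phi> \<in> M11"
  shows "\<phi> 0 = 0" "\<phi> 1 = 1"
proof -
  have im: "\<phi> ` {0..1} = {0..1}" and mono: "mono_on {0..1} \<phi>"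
    using assms by (auto simp: M11_def)
  have "\<phi> 0 \<in> {0..1}" "\<phi> 1 \<in> {0..1}" using im by (metis atLeastAtMost_iff imageI order_refl zero_le_one)+
  moreover have "{0..1} \<subseteq> {\<phi> 0..\<phi> 1}" using mono_on_image_interval[OF mono] im by simp
  ultimately show "\<phi> 0 = 0" "\<phi> 1 = 1" by auto
qed

text \<open>Elements of \<open>M11\<close> fix both ends, so they carry full decompositions to full
  decompositions, and a normalized composition is cut at \<open>1/2\<close> into two rescaled ones.
  The map \<open>h\<close> allows paths of a stage of the tower to be decomposed by paths of the
  colimit.\<close>

lemma full_pieces_gen_paths:
  assumes "p \<in> gen_paths H" and "\<And>q. q \<in> H \<Longrightarrow> pieces (full_piece G) 0 1 (h \<circ> q)"
  shows "pieces (full_piece G) 0 1 (h \<circ> p)"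
  using assms(1)
proof induction
  case (base p)
  then show ?case by (rule assms(2))
next
  case (rep p \<phi>)
  have "pieces (full_piece G) 0 1 ((h \<circ> p) \<circ> \<phi>)"
    using rep.hyps M11_ends[OF rep.hyps(2)]
    by (intro full_pieces_reparam[OF rep.IH]) (auto simp: M11_def)
  then show ?case
    by (rule full_pieces_cong) (simp add: reparam_def clamp01_def)
next
  case (comp p q)
  have "pieces (full_piece G) 0 (1/2) ((h \<circ> p) \<circ> (\<lambda>t. 2 * t))"
    by (intro full_pieces_reparam[OF comp.IH(1)]) (auto intro!: continuous_intros mono_onI)
  then have "pieces (full_piece G) 0 (1/2) (h \<circ> ncomp p q)"
    by (rule full_pieces_cong) (simp add: ncomp_def)
  moreover have "pieces (full_piece G) (1/2) 1 ((h \<circ> q) \<circ> (\<lambda>t. 2 * t - 1))"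
    by (intro full_pieces_reparam[OF comp.IH(2)]) (auto intro!: continuous_intros mono_onI)
  then have "pieces (full_piece G) (1/2) 1 (h \<circ> ncomp p q)"
  proof (rule full_pieces_cong)
    fix r :: real assume "r \<in> {1/2..1}"
    \<comment> \<open>At \<open>1/2\<close> the path \<open>ncomp p q\<close> takes its first
      branch, so \<open>p 1 = q 0\<close> is what makes the second half start correctly.\<close>
    then consider "r = 1/2" | "r > 1/2" by fastforce
    then show "((h \<circ> q) \<circ> (\<lambda>t. 2 * t - 1)) r = (h \<circ> ncomp p q) r"
    proof cases
      case 1
      then show ?thesis unfolding 1 by (simp add: ncomp_def comp.hyps(3))
    next
      case 2
      then show ?thesis by (simp add: ncomp_def)
    qed
  qed
  ultimately show ?case using pieces_trans by blast
qed

section \<open>Pushouts, chain colimits and globes\<close>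

lemma pushout_topspace:
  assumes "is_pushout A B C P i a j b"
  shows "topspace (mtop P) = j ` topspace (mtop C) \<union> b ` topspace (mtop B)"
  using assms unfolding is_pushout_def by (elim conjE)

lemma pushout_states:
  assumes "is_pushout A B C P i a j b"
  shows "mstates P = j ` mstates C \<union> b ` mstates B"
  using assms unfolding is_pushout_def by (elim conjE)

lemma pushout_paths:
  assumes "is_pushout A B C P i a j b"
  shows "mpaths P = gen_paths ((\<lambda>p. j \<circ> p) ` mpaths C \<union> (\<lambda>p. b \<circ> p) ` mpaths B)"
  using assms unfolding is_pushout_def by (elim conjE)

lemma pushout_maps:
  assumes "is_pushout A B C P i a j b"
  shows "mdmap A C a" "mdmap B P b" "\<And>x. x \<in> topspace (mtop A) \<Longrightarrow> j (a x) = b (i x)"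
proof -
  show "mdmap A C a" "mdmap B P b"
    using assms unfolding is_pushout_def by - (elim conjE, assumption)+
  have "\<forall>x\<in>topspace (mtop A). j (a x) = b (i x)"
    using assms unfolding is_pushout_def by (elim conjE)
  then show "\<And>x. x \<in> topspace (mtop A) \<Longrightarrow> j (a x) = b (i x)" by blast
qed

text \<open>Rewriting every point \<open>x\<close> of \<open>A \<subseteq> B\<close> to \<open>a x\<close> gives normal forms for the equivalence
  relation that defines the pushout.\<close>
lemma pushout_normal_form:
  fixes B :: "'y mdspace" and C :: "'z mdspace"
  assumes "is_pushout A B C P id a j b"
    and u: "u \<in> topspace (mtop B) <+> topspace (mtop C)"
    and v: "v \<in> topspace (mtop B) <+> topspace (mtop C)"
    and eq: "case_sum b j u = case_sum b j v"
  defines "nf \<equiv> case_sum (\<lambda>x. if x \<in> topspace (mtop A) then Inr (a x) else Inl x) (Inr :: 'z \<Rightarrow> 'y + 'z)"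
  shows "nf u = nf v"
proof -
  define R :: "'y + 'z \<Rightarrow> 'y + 'z \<Rightarrow> bool" where "R = (\<lambda>u v. \<exists>x\<in>topspace (mtop A). u = Inl (id x) \<and> v = Inr (a x))"
  have "\<forall>u\<in>topspace (mtop B) <+> topspace (mtop C). \<forall>v\<in>topspace (mtop B) <+> topspace (mtop C).
      case_sum b j u = case_sum b j v \<longleftrightarrow> (sup R R\<inverse>\<inverse>)\<^sup>*\<^sup>* u v"
    using assms(1) unfolding is_pushout_def Let_def R_def by (elim conjE)
  then have "(sup R R\<inverse>\<inverse>)\<^sup>*\<^sup>* u v" using u v eq by blast
  then show ?thesis
  proof induction
    case base
    show ?case by simp
  next
    case (step v w)
    have "nf v = nf w" using step.hyps(2) by (auto simp: R_def nf_def)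
    then show ?case using step.IH by simp
  qed
qed

text \<open>Every \<open>Inr x\<close> is its own normal form. Injectivity of the whole tower rests
  on this.\<close>

lemma pushout_inj:
  assumes "is_pushout A B C P id a j b"
  shows "inj_on j (topspace (mtop C))"
proof (rule inj_onI)
  fix x y assume "x \<in> topspace (mtop C)" "y \<in> topspace (mtop C)" "j x = j y"
  then show "x = y"
    using pushout_normal_form[OF assms, of "Inr x" "Inr y"] by auto
qed

text \<open>A point outside \<open>A\<close> keeps the normal form \<open>Inl x\<close>: the
  attachment identifies boundary points only.\<close>

lemma pushout_cell_inj:
  assumes "is_pushout A B C P id a j b"
    and "x \<in> topspace (mtop B) - topspace (mtop A)" "y \<in> topspace (mtop B) - topspace (mtop A)"
    and "b x = b y"
  shows "x = y"
  using pushout_normal_form[OF assms(1), of "Inl x" "Inl y"] assms(2-) by auto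

lemma pushout_cell_disjoint:
  assumes "is_pushout A B C P id a j b"
    and "x \<in> topspace (mtop B) - topspace (mtop A)" "y \<in> topspace (mtop C)"
  shows "b x \<noteq> j y"
  using pushout_normal_form[OF assms(1), of "Inl x" "Inr y"] assms(2-) by auto

lemma chain_colim_maps:
  assumes "is_chain_colim K D t P c"
  shows "k \<in> K \<Longrightarrow> mdmap (D k) P (c k)"
    "k \<in> K \<Longrightarrow> m \<in> K \<Longrightarrow> k \<le> m \<Longrightarrow> x \<in> topspace (mtop (D k)) \<Longrightarrow> c m (t k m x) = c k x"
proof -
  have "\<forall>k\<in>K. mdmap (D k) P (c k)"
    using assms unfolding is_chain_colim_def by (elim conjE)
  then show "k \<in> K \<Longrightarrow> mdmap (D k) P (c k)" by blast
  have "\<forall>k\<in>K. \<forall>m\<in>K. k \<le> m \<longrightarrow> (\<forall>x\<in>topspace (mtop (D k)). c m (t k m x) = c k x)"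
    using assms unfolding is_chain_colim_def by (elim conjE)
  then show "k \<in> K \<Longrightarrow> m \<in> K \<Longrightarrow> k \<le> m \<Longrightarrow> x \<in> topspace (mtop (D k)) \<Longrightarrow> c m (t k m x) = c k x"
    by blast
qed

lemma chain_colim_sets:
  assumes "is_chain_colim K D t P c"
  shows "topspace (mtop P) = (\<Union>k\<in>K. c k ` topspace (mtop (D k)))"
    "mstates P = (\<Union>k\<in>K. c k ` mstates (D k))"
    "mpaths P = gen_paths (\<Union>k\<in>K. (\<lambda>p. c k \<circ> p) ` mpaths (D k))"
  using assms unfolding is_chain_colim_def by - (elim conjE, assumption)+

text \<open>Two elements identified in the colimit are joined by a finite zigzag of transitions. As
  the index set is linearly ordered, some single stage lies above all indices of the zigzag, and
  there the elements already agree.\<close>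

lemma chain_colim_eqD:
  assumes "is_chain_colim K D t P c"
    and funct: "\<And>k m r x. k \<le> m \<Longrightarrow> m \<le> r \<Longrightarrow> x \<in> topspace (mtop (D k)) \<Longrightarrow>
                  t m r (t k m x) = t k r x"
    and k: "k \<in> K" and x: "x \<in> topspace (mtop (D k))" and y: "y \<in> topspace (mtop (D k))"
    and eq: "c k x = c k y"
  shows "\<exists>r\<in>K. k \<le> r \<and> t k r x = t k r y"
proof -
  define R where "R = (\<lambda>(k, x) (m, y). k \<in> K \<and> m \<in> K \<and> k \<le> m \<and>
     x \<in> topspace (mtop (D k)) \<and> y = t k m x)"
  have "\<forall>k\<in>K. \<forall>m\<in>K. \<forall>x\<in>topspace (mtop (D k)). \<forall>y\<in>topspace (mtop (D m)).
      c k x = c m y \<longleftrightarrow> (sup R R\<inverse>\<inverse>)\<^sup>*\<^sup>* (k, x) (m, y)"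
    using assms(1) unfolding is_chain_colim_def Let_def R_def by (elim conjE)
  then have "(sup R R\<inverse>\<inverse>)\<^sup>*\<^sup>* (k, x) (k, y)" using k x y eq by blast
  \<comment> \<open>The zigzag wanders through other stages, so the invariant compares the fixed
    \<open>x\<close> with an arbitrary vertex \<open>v\<close>.\<close>
  moreover have "\<exists>r\<in>K. k \<le> r \<and> fst v \<le> r \<and> t k r x = t (fst v) r (snd v)"
    if "(sup R R\<inverse>\<inverse>)\<^sup>*\<^sup>* (k, x) v" for v
    using that
  proof induction
    case base
    show ?case using k by auto
  next
    case (step v w)
    then obtain r where r: "r \<in> K" "k \<le> r" "fst v \<le> r" "t k r x = t (fst v) r (snd v)" by blast
    from step.hyps(2) consider "R v w" | "R w v" by auto
    then show ?case
    proof cases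
      case 1
      then have w: "fst v \<le> fst w" "fst w \<in> K" "snd v \<in> topspace (mtop (D (fst v)))"
          "snd w = t (fst v) (fst w) (snd v)"
        by (auto simp: R_def split: prod.splits)
      \<comment> \<open>An upward step may overtake \<open>r\<close>, so the witness is raised to
        the maximum; a downward step can keep it.\<close>
      define r' where "r' = max r (fst w)"
      have r': "r' \<in> K" "r \<le> r'" "fst w \<le> r'" using r w by (auto simp: r'_def max_def)
      have "t k r' x = t r r' (t k r x)" using funct[of k r r' x] r(2) r'(2) x by simp
      also have "\<dots> = t (fst v) r' (snd v)" using funct r r' w by simp
      also have "\<dots> = t (fst w) r' (snd w)" using funct r r' w by simp
      finally show ?thesis using r r' by (intro bexI[of _ r']) auto
    next
      case 2
      then have w: "fst w \<le> fst v" "snd w \<in> topspace (mtop (D (fst w)))"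
          "snd v = t (fst w) (fst v) (snd w)"
        by (auto simp: R_def split: prod.splits)
      have "t (fst v) r (snd v) = t (fst w) r (snd w)" using funct r w by simp
      then show ?thesis using r w by (intro bexI[of _ r]) auto
    qed
  qed
  ultimately show ?thesis by fastforce
qed

text \<open>The carrier is itself open because its preimage under \<open>gq\<close> is the full
  product, and \<open>glob_open\<close> confines every open set to it.\<close>

lemma topspace_glob [simp]: "topspace (mtop (glob Z)) = glob_carrier Z"
proof -
  have openin: "openin (mtop (glob Z)) U \<longleftrightarrow> glob_open Z U" for U
    by (simp add: glob_def topology_inverse' istopology_glob_open)
  have "{w \<in> topspace (prod_topology Z (top_of_set {0..1::real})). gq (fst w) (snd w) \<in> glob_carrier Z}
      = topspace (prod_topology Z (top_of_set {0..1}))"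
    by (auto simp: gq_def glob_carrier_def)
  then have "glob_open Z (glob_carrier Z)"
    unfolding glob_open_def by (metis openin_topspace order_refl)
  then show ?thesis
    unfolding topspace_def openin by (auto simp: glob_open_def)
qed

lemma mstates_glob [simp]: "mstates (glob Z) = {G0, G1}"
  by (simp add: glob_def)

lemma mpaths_glob:
  "mpaths (glob Z) = {(\<lambda>t. gq z (\<phi> (clamp01 t))) | z \<phi>. z \<in> topspace Z \<and> \<phi> \<in> M11}"
  by (simp add: glob_def)

lemma mdmap_topspace: "mdmap X Y h \<Longrightarrow> x \<in> topspace (mtop X) \<Longrightarrow> h x \<in> topspace (mtop Y)"
  unfolding mdmap_def by (meson continuous_map_image_subset_topspace image_subset_iff)

lemma mdspace_path_in_topspace:
  "is_mdspace X \<Longrightarrow> p \<in> mpaths X \<Longrightarrow> r \<in> {0..1} \<Longrightarrow> p r \<in> topspace (mtop X)"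
  unfolding is_mdspace_def continuous_map_def by (auto simp: Pi_iff)

section \<open>Open-cell paths of a cellular multipointed d-space\<close>

text \<open>The interface between the towers and the homeomorphism argument: it does not mention the
  tower, so \<open>X\<close> and \<open>Y\<close> may be built from unrelated ones.\<close>

definition cell_path_system :: "'a mdspace \<Rightarrow> (real \<Rightarrow> 'a) set \<Rightarrow> bool" where
  "cell_path_system X E \<longleftrightarrow>
     E \<subseteq> mpaths X \<and>
     (\<forall>x\<in>topspace (mtop X). x \<in> mstates X \<or> (\<exists>\<delta>\<in>E. \<exists>u. 0 < u \<and> u < 1 \<and> x = \<delta> u)) \<and>
     (\<forall>\<delta>\<in>E. \<forall>u. 0 < u \<and> u < 1 \<longrightarrow> \<delta> u \<notin> mstates X) \<and>
     (\<forall>\<delta>\<in>E. \<forall>\<delta>'\<in>E. \<forall>u v. 0 < u \<and> u < 1 \<and> 0 < v \<and> v < 1 \<and> \<delta> u = \<delta>' v \<longrightarrow> \<delta> = \<delta>' \<and> u = v) \<and>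
     (\<forall>p\<in>mpaths X. pieces (full_piece E) 0 1 p)"

text \<open>For each successor step, \<open>N\<close>, \<open>A\<close> and \<open>B\<close> choose
  the dimension, the attaching map and the characteristic map of the cell whose existence
  \<open>cellular_pres\<close> asserts.\<close>

locale cellular_tower =
  fixes D :: "'i::wellorder \<Rightarrow> 'c mdspace" and t :: "'i \<Rightarrow> 'i \<Rightarrow> 'c \<Rightarrow> 'c"
    and c :: "'i \<Rightarrow> 'c \<Rightarrow> 'a" and X :: "'a mdspace"
    and N :: "'i \<Rightarrow> 'i \<Rightarrow> nat" and A :: "'i \<Rightarrow> 'i \<Rightarrow> (nat \<Rightarrow> real) gpt \<Rightarrow> 'c"
    and B :: "'i \<Rightarrow> 'i \<Rightarrow> (nat \<Rightarrow> real) gpt \<Rightarrow> 'c"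
  assumes pres: "cellular_pres D t c X"
    and cell: "is_succ \<nu> s \<Longrightarrow> is_pushout (glob (top_of_set (sphere_bd (N \<nu> s))))
      (glob (top_of_set (disk (N \<nu> s)))) (D \<nu>) (D s) id (A \<nu> s) (t \<nu> s) (B \<nu> s)"
begin

text \<open>The boundary sphere is removed because the paths over it are glued to paths of the
  preceding stage.\<close>

definition cell_paths :: "(real \<Rightarrow> 'a) set" where
  "cell_paths = {(\<lambda>u. c s (B \<nu> s (gq z u))) | \<nu> s z.
     is_succ \<nu> s \<and> z \<in> disk (N \<nu> s) - sphere_bd (N \<nu> s)}"

abbreviation bottom :: 'i where "bottom \<equiv> (LEAST k. True)"

lemma bottom_le: "bottom \<le> k"
  by (simp add: Least_le)

lemma stage_mdspace: "is_mdspace (D k)"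
  using pres unfolding cellular_pres_def by (elim conjE) (rule spec)

lemma transition_mdmap: "k \<le> m \<Longrightarrow> mdmap (D k) (D m) (t k m)"
proof -
  have "\<forall>k m. k \<le> m \<longrightarrow> mdmap (D k) (D m) (t k m)"
    using pres unfolding cellular_pres_def by (elim conjE)
  then show "k \<le> m \<Longrightarrow> mdmap (D k) (D m) (t k m)" by blast
qed

lemma transition_id: "x \<in> topspace (mtop (D k)) \<Longrightarrow> t k k x = x"
proof -
  have "\<forall>k. \<forall>x\<in>topspace (mtop (D k)). t k k x = x"
    using pres unfolding cellular_pres_def by (elim conjE)
  then show "x \<in> topspace (mtop (D k)) \<Longrightarrow> t k k x = x" by blast
qed

lemma transition_comp:
  "k \<le> m \<Longrightarrow> m \<le> r \<Longrightarrow> x \<in> topspace (mtop (D k)) \<Longrightarrow> t m r (t k m x) = t k r x"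
proof -
  have "\<forall>k m r. k \<le> m \<longrightarrow> m \<le> r \<longrightarrow> (\<forall>x\<in>topspace (mtop (D k)). t m r (t k m x) = t k r x)"
    using pres unfolding cellular_pres_def by (elim conjE)
  then show "k \<le> m \<Longrightarrow> m \<le> r \<Longrightarrow> x \<in> topspace (mtop (D k)) \<Longrightarrow> t m r (t k m x) = t k r x"
    by blast
qed

lemma limit_stage: "is_limit \<nu> \<Longrightarrow> is_chain_colim {\<mu>. \<mu> < \<nu>} D t (D \<nu>) (\<lambda>\<mu>. t \<mu> \<nu>)"
proof -
  have "\<forall>\<nu>. is_limit \<nu> \<longrightarrow> is_chain_colim {\<mu>. \<mu> < \<nu>} D t (D \<nu>) (\<lambda>\<mu>. t \<mu> \<nu>)"
    using pres unfolding cellular_pres_def by (elim conjE)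
  then show "is_limit \<nu> \<Longrightarrow> is_chain_colim {\<mu>. \<mu> < \<nu>} D t (D \<nu>) (\<lambda>\<mu>. t \<mu> \<nu>)" by blast
qed

lemma colimit: "is_chain_colim UNIV D t X c"
  using pres unfolding cellular_pres_def by (elim conjE)

lemma bottom_stage:
  "mstates (D bottom) = topspace (mtop (D bottom))" "mpaths (D bottom) = {}"
proof -
  have "\<exists>S. D bottom = \<lparr> mtop = discrete_topology S, mstates = S, mpaths = {} \<rparr>"
    using pres unfolding cellular_pres_def by (elim conjE)
  then show "mstates (D bottom) = topspace (mtop (D bottom))" "mpaths (D bottom) = {}"
    by auto
qed

lemma cocone_mdmap: "mdmap (D k) X (c k)"
  using chain_colim_maps[OF colimit] by simp

lemma cocone: "k \<le> m \<Longrightarrow> x \<in> topspace (mtop (D k)) \<Longrightarrow> c m (t k m x) = c k x"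
  using chain_colim_maps[OF colimit] by simp

lemma transition_topspace:
  "k \<le> m \<Longrightarrow> x \<in> topspace (mtop (D k)) \<Longrightarrow> t k m x \<in> topspace (mtop (D m))"
  by (rule mdmap_topspace[OF transition_mdmap])

text \<open>An index other than \<open>bottom\<close> has something below it, so without an
  immediate predecessor it satisfies \<open>is_limit\<close>.\<close>

lemma stage_induct [case_names bottom succ limit]:
  assumes "P bottom"
    and "\<And>\<nu> s. is_succ \<nu> s \<Longrightarrow> P \<nu> \<Longrightarrow> P s"
    and "\<And>\<nu>. is_limit \<nu> \<Longrightarrow> (\<And>\<mu>. \<mu> < \<nu> \<Longrightarrow> P \<mu>) \<Longrightarrow> P \<nu>"
  shows "P k"
proof (induction k rule: less_induct)
  case (less k)
  consider "k = bottom" | \<nu> where "is_succ \<nu> k" | "is_limit k"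
    using bottom_le[of k] unfolding is_limit_def by (metis order_le_less)
  then show ?case
  proof cases
    case 1
    then show ?thesis using assms(1) by simp
  next
    case (2 \<nu>)
    then show ?thesis using assms(2) less by (auto simp: is_succ_def)
  next
    case 3
    then show ?thesis using assms(3) less by blast
  qed
qed

lemma is_succ_le: "is_succ \<nu> s \<Longrightarrow> k < s \<Longrightarrow> k \<le> \<nu>"
  unfolding is_succ_def by (metis leD leI)

lemma is_succ_less: "is_succ \<nu> s \<Longrightarrow> \<nu> < s"
  unfolding is_succ_def by blast

lemma is_succ_unique: "is_succ \<nu> s \<Longrightarrow> is_succ \<nu>' s \<Longrightarrow> \<nu> = \<nu>'"
  by (meson is_succ_le is_succ_less order_antisym)

text \<open>At a successor, the last transition is an injective pushout leg. At a limit, any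
  identification already happens at an earlier stage, where the induction hypothesis excludes
  it.\<close>

lemma transition_inj: "k \<le> m \<Longrightarrow> inj_on (t k m) (topspace (mtop (D k)))"
proof (induction m arbitrary: k rule: stage_induct)
  case bottom
  then have "k = bottom" using bottom_le[of k] by (rule order_antisym)
  then show ?case using transition_id by (auto intro!: inj_onI)
next
  case (succ \<nu> s)
  show ?case
  proof (cases "k = s")
    case True
    then show ?thesis using transition_id by (auto intro!: inj_onI)
  next
    case False
    then have k: "k \<le> \<nu>" "\<nu> \<le> s" using succ.prems is_succ_le[OF succ.hyps, of k] is_succ_less[OF succ.hyps] by auto
    show ?thesis
    proof (rule inj_onI)
      fix x y assume xy: "x \<in> topspace (mtop (D k))" "y \<in> topspace (mtop (D k))" "t k s x = t k s y"
      then have "t \<nu> s (t k \<nu> x) = t \<nu> s (t k \<nu> y)" using transition_comp k by simp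
      then have "t k \<nu> x = t k \<nu> y"
        using inj_onD[OF pushout_inj[OF cell[OF succ.hyps]]] transition_topspace k xy by blast
      then show "x = y" using inj_onD[OF succ.IH[OF k(1)]] xy by blast
    qed
  qed
next
  case (limit \<nu>)
  show ?case
  proof (cases "k = \<nu>")
    case True
    then show ?thesis using transition_id by (auto intro!: inj_onI)
  next
    case False
    then have k: "k < \<nu>" using limit by simp
    show ?thesis
    proof (rule inj_onI)
      fix x y assume xy: "x \<in> topspace (mtop (D k))" "y \<in> topspace (mtop (D k))" "t k \<nu> x = t k \<nu> y"
      then obtain r where "r < \<nu>" "k \<le> r" "t k r x = t k r y"
        using chain_colim_eqD[OF limit_stage[OF limit.hyps] transition_comp, of k x y] k by auto
      then show "x = y" using inj_onD[OF limit.IH] xy by blast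
    qed
  qed
qed

lemma cocone_inj: "inj_on (c k) (topspace (mtop (D k)))"
proof (rule inj_onI)
  fix x y assume xy: "x \<in> topspace (mtop (D k))" "y \<in> topspace (mtop (D k))" "c k x = c k y"
  then obtain r where "k \<le> r" "t k r x = t k r y"
    using chain_colim_eqD[OF colimit transition_comp, of k x y] by auto
  then show "x = y" using inj_onD[OF transition_inj] xy by blast
qed

lemma open_cell_point:
  assumes "z \<in> disk n - sphere_bd n" "0 < u" "u < 1"
  shows "gq z u \<in> topspace (mtop (glob (top_of_set (disk n)))) -
    topspace (mtop (glob (top_of_set (sphere_bd n))))"
  using assms by (auto simp: gq_def glob_carrier_def)

lemma cell_topspace:
  assumes "is_succ \<nu> s" "w \<in> glob_carrier (top_of_set (disk (N \<nu> s)))"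
  shows "B \<nu> s w \<in> topspace (mtop (D s))"
  using mdmap_topspace[OF pushout_maps(2)[OF cell[OF assms(1)]]] assms(2) by simp

text \<open>Both points are compared inside \<open>D s\<close>, on which \<open>c s\<close> is
  injective. There the earlier point comes from \<open>D \<nu>\<close>, whose image avoids the
  interior of the attached cell.\<close>

lemma cell_not_earlier:
  assumes "is_succ \<nu> s" "z \<in> disk (N \<nu> s) - sphere_bd (N \<nu> s)" "0 < u" "u < 1"
    and "k < s" "x \<in> topspace (mtop (D k))"
  shows "c s (B \<nu> s (gq z u)) \<noteq> c k x"
proof
  assume eq: "c s (B \<nu> s (gq z u)) = c k x"
  have k: "k \<le> \<nu>" "\<nu> < s" using assms is_succ_le is_succ_less by blast+
  note w = open_cell_point[OF assms(2-4)]
  have "c k x = c s (t \<nu> s (t k \<nu> x))"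
    using cocone[of k s x] transition_comp[of k \<nu> s x] k assms by simp
  moreover have "t \<nu> s (t k \<nu> x) \<in> topspace (mtop (D s))"
    using transition_topspace k assms by simp
  moreover have "B \<nu> s (gq z u) \<in> topspace (mtop (D s))"
    using cell_topspace[OF assms(1)] w by simp
  ultimately have "B \<nu> s (gq z u) = t \<nu> s (t k \<nu> x)"
    using inj_onD[OF cocone_inj] eq by metis
  then show False
    using pushout_cell_disjoint[OF cell[OF assms(1)] w] transition_topspace k assms by blast
qed

section \<open>Open-cell paths partition the points that are not states\<close>

lemma cell_paths_subset: "cell_paths \<subseteq> mpaths X"
proof
  fix \<delta> assume "\<delta> \<in> cell_paths"
  then obtain \<nu> s z where s: "is_succ \<nu> s" and z: "z \<in> disk (N \<nu> s)"
    and \<delta>: "\<delta> = (\<lambda>u. c s (B \<nu> s (gq z u)))"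
    unfolding cell_paths_def by blast
  have "(\<lambda>u. u) \<in> M11" by (auto simp: M11_def intro!: mono_onI)
  \<comment> \<open>\<open>gq\<close> is already constant outside the unit interval, so the identity
    of \<open>M11\<close> exhibits \<open>gq z\<close> as an execution path.\<close>
  moreover have "gq z = (\<lambda>t. gq z (clamp01 t))" by (auto simp: gq_def clamp01_def)
  ultimately have "gq z \<in> mpaths (glob (top_of_set (disk (N \<nu> s))))"
    using z unfolding mpaths_glob by force
  then have "B \<nu> s \<circ> gq z \<in> mpaths (D s)"
    using pushout_maps(2)[OF cell[OF s]] unfolding mdmap_def by blast
  then have "c s \<circ> (B \<nu> s \<circ> gq z) \<in> mpaths X"
    using cocone_mdmap[of s] unfolding mdmap_def by blast
  then show "\<delta> \<in> mpaths X" by (simp add: \<delta> comp_def)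
qed

text \<open>A successor stage adds only the points over the open disk with parameter strictly
  between 0 and 1; all others come from the stage before. A limit stage adds none.\<close>

lemma stage_points:
  "x \<in> topspace (mtop (D k)) \<Longrightarrow>
     c k x \<in> mstates X \<or> (\<exists>\<delta>\<in>cell_paths. \<exists>u. 0 < u \<and> u < 1 \<and> c k x = \<delta> u)"
proof (induction k arbitrary: x rule: stage_induct)
  case bottom
  then show ?case using cocone_mdmap[of bottom] bottom_stage(1) unfolding mdmap_def by blast
next
  case (succ \<nu> s)
  have earlier: ?case if "x = t \<nu> s y" "y \<in> topspace (mtop (D \<nu>))" for y
    using that succ.IH[of y] cocone[of \<nu> s y] is_succ_less[OF succ.hyps] by simp
  note po = cell[OF succ.hyps]
  from succ.prems consider y where "x = t \<nu> s y" "y \<in> topspace (mtop (D \<nu>))"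
    | w where "x = B \<nu> s w" "w \<in> glob_carrier (top_of_set (disk (N \<nu> s)))"
    unfolding pushout_topspace[OF po] by auto
  then show ?case
  proof cases
    case 1
    then show ?thesis using earlier by blast
  next
    case (2 w)
    show ?thesis
    proof (cases "w \<in> glob_carrier (top_of_set (sphere_bd (N \<nu> s)))")
      case True
      \<comment> \<open>This case includes \<open>G0\<close> and \<open>G1\<close>, which belong to
        the boundary globe even when the sphere is empty; the attaching map moves \<open>w\<close>
        back to \<open>D \<nu>\<close>.\<close>
      then have "t \<nu> s (A \<nu> s w) = x" "A \<nu> s w \<in> topspace (mtop (D \<nu>))"
        using pushout_maps(3)[OF po, of w] mdmap_topspace[OF pushout_maps(1)[OF po], of w] 2 by auto
      then show ?thesis using earlier by blast
    next
      case False
      then obtain z u where zu: "w = GM z u" "0 < u" "u < 1" "z \<in> disk (N \<nu> s) - sphere_bd (N \<nu> s)"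
        using 2 unfolding glob_carrier_def by auto
      then have "c s x = (\<lambda>u. c s (B \<nu> s (gq z u))) u" using 2 by (simp add: gq_def)
      moreover have "(\<lambda>u. c s (B \<nu> s (gq z u))) \<in> cell_paths"
        using zu succ.hyps unfolding cell_paths_def by blast
      ultimately show ?thesis using zu(2,3) by (intro disjI2 bexI exI conjI)
    qed
  qed
next
  case (limit \<nu>)
  then obtain \<mu> y where "\<mu> < \<nu>" "y \<in> topspace (mtop (D \<mu>))" "x = t \<mu> \<nu> y"
    using chain_colim_sets(1)[OF limit_stage[OF limit.hyps]] by auto
  then show ?case using limit.IH[of \<mu> y] cocone[of \<mu> \<nu> y] by simp
qed

text \<open>Attaching a cell creates no state: the two states of the globe lie in the boundary
  globe, and the attaching map sends them to states of the previous stage.\<close>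

lemma stage_states: "x \<in> mstates (D k) \<Longrightarrow> c k x \<in> c bottom ` topspace (mtop (D bottom))"
proof (induction k arbitrary: x rule: stage_induct)
  case bottom
  then show ?case using bottom_stage(1) by blast
next
  case (succ \<nu> s)
  note po = cell[OF succ.hyps]
  have "\<exists>y\<in>mstates (D \<nu>). x = t \<nu> s y"
  proof (cases "x \<in> t \<nu> s ` mstates (D \<nu>)")
    case False
    then obtain w where w: "w \<in> {G0, G1}" "x = B \<nu> s w"
      using succ.prems unfolding pushout_states[OF po] by auto
    have "A \<nu> s w \<in> mstates (D \<nu>)"
      using pushout_maps(1)[OF po] w(1) unfolding mdmap_def by auto
    moreover have "x = t \<nu> s (A \<nu> s w)"
      using pushout_maps(3)[OF po, of w] w by (auto simp: glob_carrier_def)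
    ultimately show ?thesis by blast
  qed blast
  then obtain y where y: "y \<in> mstates (D \<nu>)" "x = t \<nu> s y" by blast
  then have "y \<in> topspace (mtop (D \<nu>))" using stage_mdspace[of \<nu>] unfolding is_mdspace_def by blast
  then have "c s x = c \<nu> y" using cocone[of \<nu> s y] is_succ_less[OF succ.hyps] y by simp
  then show ?case using succ.IH y by simp
next
  case (limit \<nu>)
  then obtain \<mu> y where y: "\<mu> < \<nu>" "y \<in> mstates (D \<mu>)" "x = t \<mu> \<nu> y"
    using chain_colim_sets(2)[OF limit_stage[OF limit.hyps]] by auto
  then have "y \<in> topspace (mtop (D \<mu>))" using stage_mdspace[of \<mu>] unfolding is_mdspace_def by blast
  then have "c \<nu> x = c \<mu> y" using cocone[of \<mu> \<nu> y] y by simp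
  then show ?case using limit.IH y by simp
qed

lemma cell_path_not_state:
  assumes "\<delta> \<in> cell_paths" "0 < u" "u < 1"
  shows "\<delta> u \<notin> mstates X"
proof
  assume "\<delta> u \<in> mstates X"
  then obtain k y where "y \<in> mstates (D k)" "\<delta> u = c k y"
    unfolding chain_colim_sets(2)[OF colimit] by blast
  then have "\<delta> u \<in> c bottom ` topspace (mtop (D bottom))" using stage_states by simp
  then obtain x where x: "x \<in> topspace (mtop (D bottom))" "\<delta> u = c bottom x" by blast
  obtain \<nu> s z where s: "is_succ \<nu> s" "z \<in> disk (N \<nu> s) - sphere_bd (N \<nu> s)"
    and \<delta>: "\<delta> = (\<lambda>u. c s (B \<nu> s (gq z u)))"
    using assms(1) unfolding cell_paths_def by blast
  have "bottom < s" using bottom_le[of \<nu>] is_succ_less[OF s(1)] by (rule order_le_less_trans)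
  then show False using cell_not_earlier[OF s assms(2,3) _ x(1)] x(2) \<delta> by simp
qed

text \<open>If the cells had different stages, the point would lie in the open cell of the later one
  and come from the earlier stage. Equal stages mean the same cell, as predecessors are unique, and
  the cell is injective off its boundary.\<close>

lemma cell_path_unique:
  assumes "\<delta> \<in> cell_paths" "\<delta>' \<in> cell_paths" "0 < u" "u < 1" "0 < v" "v < 1" "\<delta> u = \<delta>' v"
  shows "\<delta> = \<delta>' \<and> u = v"
proof -
  obtain \<nu> s z where s: "is_succ \<nu> s" "z \<in> disk (N \<nu> s) - sphere_bd (N \<nu> s)"
    and \<delta>: "\<delta> = (\<lambda>u. c s (B \<nu> s (gq z u)))"
    using assms(1) unfolding cell_paths_def by blast
  obtain \<nu>' s' z' where s': "is_succ \<nu>' s'" "z' \<in> disk (N \<nu>' s') - sphere_bd (N \<nu>' s')"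
    and \<delta>': "\<delta>' = (\<lambda>u. c s' (B \<nu>' s' (gq z' u)))"
    using assms(2) unfolding cell_paths_def by blast
  note w = open_cell_point[OF s(2) assms(3,4)] and w' = open_cell_point[OF s'(2) assms(5,6)]
  have top: "B \<nu> s (gq z u) \<in> topspace (mtop (D s))" "B \<nu>' s' (gq z' v) \<in> topspace (mtop (D s'))"
    using cell_topspace s s' w w' by auto
  have eq: "c s (B \<nu> s (gq z u)) = c s' (B \<nu>' s' (gq z' v))" using assms(7) \<delta> \<delta>' by simp
  have "\<not> s < s'" using cell_not_earlier[OF s' assms(5,6) _ top(1)] eq by auto
  moreover have "\<not> s' < s" using cell_not_earlier[OF s assms(3,4) _ top(2)] eq by auto
  ultimately have [simp]: "s' = s" by simp
  then have [simp]: "\<nu>' = \<nu>" using is_succ_unique s s' by blast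
  have "B \<nu> s (gq z u) = B \<nu> s (gq z' v)"
    using inj_onD[OF cocone_inj[of s]] eq top by simp
  then have "gq z u = gq z' v"
    using pushout_cell_inj[OF cell[OF s(1)] w] w' by simp
  then have "z = z'" "u = v" using assms by (auto simp: gq_def)
  then show ?thesis using \<delta> \<delta>' by simp
qed

section \<open>Execution paths as concatenations of open-cell paths\<close>

lemma transition_path_pieces:
  assumes "k \<le> m" "q \<in> mpaths (D k)" "pieces (full_piece G) 0 1 (c k \<circ> q)"
  shows "pieces (full_piece G) 0 1 (c m \<circ> (t k m \<circ> q))"
  using assms(3)
proof (rule full_pieces_cong)
  \<comment> \<open>The cocone equation is available only at points of \<open>D k\<close>, so the
    two paths are compared on the unit interval.\<close>
  fix r :: real assume "r \<in> {0..1}"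
  then have "q r \<in> topspace (mtop (D k))"
    using mdspace_path_in_topspace[OF stage_mdspace assms(2)] by blast
  then show "(c k \<circ> q) r = (c m \<circ> (t k m \<circ> q)) r" using cocone assms(1) by simp
qed

text \<open>Each stage is handled through the generators of its execution paths. They come from
  earlier stages or run through the new globe; the latter are full traversals of one open-cell path,
  or come from the previous stage when they lie over the boundary sphere.\<close>

lemma stage_path_pieces:
  "p \<in> mpaths (D k) \<Longrightarrow> pieces (full_piece cell_paths) 0 1 (c k \<circ> p)"
proof (induction k arbitrary: p rule: stage_induct)
  case bottom
  then show ?case using bottom_stage(2) by simp
next
  case (succ \<nu> s)
  note po = cell[OF succ.hyps]
  have \<nu>s: "\<nu> \<le> s" using is_succ_less[OF succ.hyps] by simp
  show ?case
    using succ.prems unfolding pushout_paths[OF po]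
  proof (rule full_pieces_gen_paths)
    fix q assume "q \<in> (\<circ>) (t \<nu> s) ` mpaths (D \<nu>) \<union>
      (\<circ>) (B \<nu> s) ` mpaths (glob (top_of_set (disk (N \<nu> s))))"
    then consider q' where "q' \<in> mpaths (D \<nu>)" "q = t \<nu> s \<circ> q'"
      | z \<phi> where "z \<in> disk (N \<nu> s)" "\<phi> \<in> M11" "q = B \<nu> s \<circ> (\<lambda>t. gq z (\<phi> (clamp01 t)))"
      unfolding mpaths_glob by auto
    then show "pieces (full_piece cell_paths) 0 1 (c s \<circ> q)"
    proof cases
      case 1
      then show ?thesis using transition_path_pieces[OF \<nu>s _ succ.IH] by simp
    next
      case (2 z \<phi>)
      show ?thesis
      proof (cases "z \<in> sphere_bd (N \<nu> s)")
        case True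
        let ?q = "\<lambda>t. gq z (\<phi> (clamp01 t))"
        have "?q \<in> mpaths (glob (top_of_set (sphere_bd (N \<nu> s))))"
          using True 2 unfolding mpaths_glob by auto
        then have "A \<nu> s \<circ> ?q \<in> mpaths (D \<nu>)"
          using pushout_maps(1)[OF po] unfolding mdmap_def by blast
        then have "pieces (full_piece cell_paths) 0 1 (c s \<circ> (t \<nu> s \<circ> (A \<nu> s \<circ> ?q)))"
          using transition_path_pieces[OF \<nu>s _ succ.IH] by simp
        moreover have "?q r \<in> glob_carrier (top_of_set (sphere_bd (N \<nu> s)))" for r
          using True by (auto simp: gq_def glob_carrier_def)
        then have "t \<nu> s \<circ> (A \<nu> s \<circ> ?q) = q"
          using pushout_maps(3)[OF po] 2 by (auto simp: fun_eq_iff)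
        ultimately show ?thesis by simp
      next
        case False
        then have "(\<lambda>u. c s (B \<nu> s (gq z u))) \<in> cell_paths"
          using 2 succ.hyps unfolding cell_paths_def by blast
        moreover have "\<forall>r\<in>{0..1}. (c s \<circ> q) r = (\<lambda>u. c s (B \<nu> s (gq z u))) (\<phi> r)"
          using 2 by (simp add: clamp01_def)
        moreover have "continuous_on {0..1} \<phi>" "mono_on {0..1} \<phi>" "\<phi> 0 = 0" "\<phi> 1 = 1"
          using 2 M11_ends[of \<phi>] by (auto simp: M11_def)
        ultimately have "full_piece cell_paths 0 1 (c s \<circ> q)"
          unfolding full_piece_def by (intro conjI bexI exI zero_less_one)
        then show ?thesis by (rule pieces.single)
      qed
    qed
  qed
next
  case (limit \<nu>)
  show ?case
    using limit.prems unfolding chain_colim_sets(3)[OF limit_stage[OF limit.hyps]]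
  proof (rule full_pieces_gen_paths)
    fix q assume "q \<in> (\<Union>k\<in>{\<mu>. \<mu> < \<nu>}. (\<circ>) (t k \<nu>) ` mpaths (D k))"
    then obtain \<mu> q' where "\<mu> < \<nu>" "q' \<in> mpaths (D \<mu>)" "q = t \<mu> \<nu> \<circ> q'" by blast
    then show "pieces (full_piece cell_paths) 0 1 (c \<nu> \<circ> q)"
      using transition_path_pieces[OF _ _ limit.IH] by (metis less_imp_le)
  qed
qed

lemma path_pieces:
  assumes "p \<in> mpaths X"
  shows "pieces (full_piece cell_paths) 0 1 p"
proof -
  have "pieces (full_piece cell_paths) 0 1 (id \<circ> p)"
    using assms unfolding chain_colim_sets(3)[OF colimit]
    by (rule full_pieces_gen_paths) (auto intro: stage_path_pieces)
  then show ?thesis by simp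
qed

lemma cell_path_system: "cell_path_system X cell_paths"
  unfolding cell_path_system_def
proof (intro conjI)
  show "\<forall>x\<in>topspace (mtop X). x \<in> mstates X \<or> (\<exists>\<delta>\<in>cell_paths. \<exists>u. 0 < u \<and> u < 1 \<and> x = \<delta> u)"
    using stage_points unfolding chain_colim_sets(1)[OF colimit] by blast
qed (use cell_paths_subset cell_path_not_state cell_path_unique path_pieces in blast)+

end

lemma cellular_pres_imp_cell_path_system:
  assumes "cellular_pres D t c X"
  shows "\<exists>E. cell_path_system X E"
proof -
  have "\<forall>\<nu> s. is_succ \<nu> s \<longrightarrow> (\<exists>n a b. is_pushout (glob (top_of_set (sphere_bd n)))
      (glob (top_of_set (disk n))) (D \<nu>) (D s) id a (t \<nu> s) b)"
    using assms unfolding cellular_pres_def by (elim conjE)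
  then obtain N A B where "\<And>\<nu> s. is_succ \<nu> s \<Longrightarrow> is_pushout (glob (top_of_set (sphere_bd (N \<nu> s))))
      (glob (top_of_set (disk (N \<nu> s)))) (D \<nu>) (D s) id (A \<nu> s) (t \<nu> s) (B \<nu> s)"
    by metis
  then interpret cellular_tower D t c X N A B
    using assms by unfold_locales
  show ?thesis using cell_path_system by blast
qed

section \<open>Pulling back directed paths along a homeomorphism\<close>

text \<open>Injectivity is asked only on the open interval because a cell path may begin and end at
  the same state. Monotonicity extends it to the closed interval.\<close>

lemma strictly_increasing_inverse:
  fixes \<phi> :: "real \<Rightarrow> real"
  assumes "a < b" "continuous_on {a..b} \<phi>" "mono_on {a..b} \<phi>" "\<phi> a = 0" "\<phi> b = 1"
    and inj: "inj_on \<phi> {a<..<b}"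
  obtains \<psi> where "continuous_on {0..1} \<psi>" "mono_on {0..1} \<psi>" "\<psi> ` {0..1} \<subseteq> {a..b}"
    "\<And>v. v \<in> {0..1} \<Longrightarrow> \<phi> (\<psi> v) = v"
proof -
  have strict: "\<phi> x < \<phi> y" if "x \<in> {a..b}" "y \<in> {a..b}" "x < y" for x y
  proof -
    \<comment> \<open>The points at one third and two thirds are interior even if \<open>x\<close>
      and \<open>y\<close> are the end points, so \<open>\<phi>\<close> strictly increases between
      them.\<close>
    define x' where "x' = (2 * x + y) / 3"
    define y' where "y' = (x + 2 * y) / 3"
    have xy: "x < x'" "x' < y'" "y' < y" using that by (auto simp: x'_def y'_def)
    then have "\<phi> x \<le> \<phi> x'" "\<phi> x' \<le> \<phi> y'" "\<phi> y' \<le> \<phi> y"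
      using that by (auto intro!: mono_onD[OF assms(3)])
    moreover have "\<phi> x' \<noteq> \<phi> y'" using inj_onD[OF inj, of x' y'] xy that by auto
    ultimately show ?thesis by linarith
  qed
  then have injc: "inj_on \<phi> {a..b}"
    by (intro inj_onI) (metis less_irrefl linorder_neqE)
  have "{0..1} \<subseteq> \<phi> ` {a..b}"
  proof
    fix v :: real assume "v \<in> {0..1}"
    then show "v \<in> \<phi> ` {a..b}"
      using IVT'[of \<phi> a v b] assms by auto
  qed
  moreover have "\<phi> ` {a..b} \<subseteq> {0..1}"
    using mono_on_image_interval[OF assms(3)] assms(4,5) by simp
  ultimately have im: "\<phi> ` {a..b} = {0..1}" by blast
  define \<psi> where "\<psi> = inv_into {a..b} \<phi>"
  have in_ab: "\<psi> v \<in> {a..b}" and right_inv: "\<phi> (\<psi> v) = v" if "v \<in> {0..1}" for v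
    using that inv_into_into[of v \<phi> "{a..b}"] f_inv_into_f[of v \<phi> "{a..b}"]
    unfolding im \<psi>_def by auto
  \<comment> \<open>A continuous injection on a compact interval has a continuous inverse on its
    image.\<close>
  have "continuous_on (\<phi> ` {a..b}) \<psi>"
    using assms(2) by (rule continuous_on_inv) (auto simp: \<psi>_def inv_into_f_f[OF injc])
  moreover have "mono_on {0..1} \<psi>"
  proof (rule mono_onI)
    fix u v :: real assume uv: "u \<in> {0..1}" "v \<in> {0..1}" "u \<le> v"
    show "\<psi> u \<le> \<psi> v"
    proof (rule ccontr)
      assume "\<not> \<psi> u \<le> \<psi> v"
      then have "\<phi> (\<psi> v) < \<phi> (\<psi> u)" using strict in_ab uv by simp
      then show False using right_inv uv by simp
    qed
  qed
  moreover have "\<psi> ` {0..1} \<subseteq> {a..b}" using in_ab by blast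
  ultimately show ?thesis using that right_inv im by metis
qed

text \<open>A single cell path \<open>\<delta>'\<close> of \<open>X\<close> suffices because the
  full piece of \<open>f \<circ> \<delta>'\<close> through the meeting point traverses all of
  \<open>\<delta>\<close>, ends included.\<close>

lemma cell_path_pullback:
  assumes X: "is_mdspace X" and Y: "is_mdspace Y" and f: "mdmap X Y f"
    and E: "cell_path_system X E" and F: "cell_path_system Y F"
    and g: "\<And>y. y \<in> topspace (mtop Y) \<Longrightarrow> g y \<in> topspace (mtop X)"
    and gf: "\<And>x. x \<in> topspace (mtop X) \<Longrightarrow> g (f x) = x"
    and fg: "\<And>y. y \<in> topspace (mtop Y) \<Longrightarrow> f (g y) = y"
    and \<delta>: "\<delta> \<in> F"
  shows "directed_piece (mpaths X) 0 1 (g \<circ> \<delta>)"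
proof -
  have sub: "E \<subseteq> mpaths X" "F \<subseteq> mpaths Y"
    using E F unfolding cell_path_system_def by blast+
  let ?y = "\<delta> (1/2)"
  have y: "?y \<in> topspace (mtop Y)" "?y \<notin> mstates Y"
    using mdspace_path_in_topspace[OF Y, of \<delta> "1/2"] \<delta> sub(2) F
    unfolding cell_path_system_def by auto
  \<comment> \<open>\<open>f\<close> preserves states, so a state \<open>g ?y\<close> would make
    \<open>f (g ?y) = ?y\<close> a state of \<open>Y\<close>.\<close>
  have "g ?y \<notin> mstates X"
    using y fg f unfolding mdmap_def by force
  then obtain \<delta>' s where \<delta>': "\<delta>' \<in> E" and s: "0 < s" "s < 1" "g ?y = \<delta>' s"
    using E g[OF y(1)] unfolding cell_path_system_def by blast
  have "f \<circ> \<delta>' \<in> mpaths Y" using \<delta>' sub(1) f unfolding mdmap_def by blast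
  then have "pieces (full_piece F) 0 1 (f \<circ> \<delta>')"
    using F unfolding cell_path_system_def by blast
  then have "\<exists>a b. 0 \<le> a \<and> s \<in> {a..b} \<and> b \<le> 1 \<and> full_piece F a b (f \<circ> \<delta>')"
    by (rule pieces_locate) (use full_piece_less s in auto)
  then obtain a b where ab: "0 \<le> a" "s \<in> {a..b}" "b \<le> 1" "full_piece F a b (f \<circ> \<delta>')"
    by blast
  then obtain \<delta>'' \<phi> where "a < b" and \<delta>'': "\<delta>'' \<in> F"
    and \<phi>: "continuous_on {a..b} \<phi>" "mono_on {a..b} \<phi>" "\<phi> a = 0" "\<phi> b = 1"
      "\<forall>r\<in>{a..b}. (f \<circ> \<delta>') r = \<delta>'' (\<phi> r)"
    unfolding full_piece_def by blast
  have meet: "\<delta>'' (\<phi> s) = ?y" using \<phi>(5) ab(2) s(3) fg[OF y(1)] by (metis comp_apply)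
  \<comment> \<open>Uniqueness in \<open>F\<close> applies only at interior parameters. The ends of
    \<open>\<delta>''\<close> are states and \<open>?y\<close> is not, so \<open>\<phi> s\<close> is
    interior.\<close>
  have "\<delta>'' 0 \<in> mstates Y" "\<delta>'' 1 \<in> mstates Y"
    using \<delta>'' sub(2) Y unfolding is_mdspace_def by blast+
  then have "\<phi> s \<noteq> 0" "\<phi> s \<noteq> 1" using meet y(2) by metis+
  moreover have "\<phi> s \<in> {0..1}"
    using mono_on_image_interval[OF \<phi>(2)] \<phi>(3,4) ab(2) by (metis imageI subsetD)
  ultimately have "0 < \<phi> s" "\<phi> s < 1" by auto
  moreover have "(0::real) < 1/2" "1/2 < (1::real)" by simp_all
  ultimately have "\<delta>'' = \<delta>"
    using F \<delta> \<delta>'' meet unfolding cell_path_system_def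
    by blast
  have top: "\<delta>' r \<in> topspace (mtop X)" if "r \<in> {a..b}" for r
    using mdspace_path_in_topspace[OF X, of \<delta>' r] \<delta>' sub(1) that ab by auto
  have pull: "g (\<delta> (\<phi> r)) = \<delta>' r" if "r \<in> {a..b}" for r
    using \<phi>(5) that gf[OF top[OF that]] by (metis \<open>\<delta>'' = \<delta>\<close> comp_apply)
  \<comment> \<open>Applying \<open>g\<close> recovers \<open>\<delta>'\<close>, so
    \<open>\<phi>\<close> cannot merge parameters that \<open>\<delta>'\<close> separates, and a
    cell path separates all interior ones.\<close>
  have "inj_on \<phi> {a<..<b}"
  proof (rule inj_onI)
    fix r r' assume r: "r \<in> {a<..<b}" "r' \<in> {a<..<b}" "\<phi> r = \<phi> r'"
    then have "\<delta>' r = \<delta>' r'" using pull[of r] pull[of r'] by simp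
    moreover have "0 < r" "r < 1" "0 < r'" "r' < 1" using r ab by auto
    ultimately show "r = r'" using E \<delta>' unfolding cell_path_system_def by blast
  qed
  then obtain \<psi> where \<psi>: "continuous_on {0..1} \<psi>" "mono_on {0..1} \<psi>" "\<psi> ` {0..1} \<subseteq> {a..b}"
      "\<And>v. v \<in> {0..1} \<Longrightarrow> \<phi> (\<psi> v) = v"
    using strictly_increasing_inverse[OF \<open>a < b\<close> \<phi>(1-4)] by blast
  have "\<psi> ` {0..1} \<subseteq> {0..1}" using \<psi>(3) ab by fastforce
  moreover have "\<forall>v\<in>{0..1}. (g \<circ> \<delta>) v = \<delta>' (\<psi> v)"
    using pull \<psi>(3,4) by (metis comp_apply image_subset_iff)
  moreover have "\<delta>' \<in> mpaths X" using \<delta>' sub(1) by blast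
  ultimately show ?thesis
    unfolding directed_piece_def using \<psi>(1,2) zero_less_one by blast
qed

section \<open>Directed maps tested on execution paths\<close>

lemma pieces_bind:
  assumes "pieces B a b p" and "\<And>a b p. B a b p \<Longrightarrow> pieces B' a b (h \<circ> p)"
  shows "pieces B' a b (h \<circ> p)"
  using assms(1)
proof induction
  case (single a b p)
  then show ?case by (rule assms(2))
next
  case (snoc a b p c)
  then show ?case using pieces_trans[OF assms(2)] by blast
qed

text \<open>A piece may run through only part of its generator \<open>\<gamma>\<close>;
  reparametrizing the decomposition of \<open>h \<circ> \<gamma>\<close> cuts it down to that
  part.\<close>

lemma directed_pieces_transport:
  assumes base: "\<And>\<gamma>. \<gamma> \<in> G \<Longrightarrow> pieces (directed_piece H) 0 1 (h \<circ> \<gamma>)"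
    and "directed_piece G a b p"
  shows "pieces (directed_piece H) a b (h \<circ> p)"
proof -
  obtain \<gamma> \<phi> where "a < b" and \<gamma>: "\<gamma> \<in> G"
    and \<phi>: "continuous_on {a..b} \<phi>" "mono_on {a..b} \<phi>" "\<phi> ` {a..b} \<subseteq> {0..1}"
      "\<forall>r\<in>{a..b}. p r = \<gamma> (\<phi> r)"
    using assms(2) unfolding directed_piece_def by blast
  have "pieces (directed_piece H) a b ((h \<circ> \<gamma>) \<circ> \<phi>)"
    using base[OF \<gamma>] \<open>a < b\<close> \<phi>(1-3) by (rule directed_pieces_reparam)
  then show ?thesis by (rule directed_pieces_cong) (simp add: \<phi>(4))
qed

lemma full_piece_imp_directed_piece: "full_piece G a b p \<Longrightarrow> directed_piece G a b p"
  unfolding full_piece_def directed_piece_def using mono_on_image_interval by metis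

text \<open>Constants go to constants, and a Moore concatenation is refined piece by piece, so only
  execution paths have to be examined.\<close>

lemma dmap_SpI:
  assumes "continuous_map (mtop X) (mtop Y) h"
    and "\<And>\<gamma>. \<gamma> \<in> mpaths X \<Longrightarrow> pieces (directed_piece (mpaths Y)) 0 1 (h \<circ> \<gamma>)"
  shows "dmap (Sp X) (Sp Y) h"
  unfolding dmap_def
proof (intro conjI ballI)
  show "continuous_map (dtop (Sp X)) (dtop (Sp Y)) h" using assms(1) by (simp add: Sp_def)
  fix p assume "p \<in> dpaths (Sp X)"
  then have p: "normal_path p" "(\<exists>x\<in>topspace (mtop X). p = (\<lambda>t. x)) \<or> moore_concat_path X p"
    by (auto simp: Sp_def)
  have "normal_path (h \<circ> p)" using p(1) unfolding normal_path_def comp_def by metis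
  moreover have "(\<exists>y\<in>topspace (mtop Y). h \<circ> p = (\<lambda>t. y)) \<or> moore_concat_path Y (h \<circ> p)"
    using p(2)
  proof
    assume "\<exists>x\<in>topspace (mtop X). p = (\<lambda>t. x)"
    then show ?thesis
      using continuous_map_image_subset_topspace[OF assms(1)] by (auto simp: comp_def)
  next
    assume "moore_concat_path X p"
    then have "pieces (directed_piece (mpaths Y)) 0 1 (h \<circ> p)"
      by (intro pieces_bind[OF moore_concat_path_imp_pieces] directed_pieces_transport[OF assms(2)])
    then show ?thesis using pieces_imp_moore_concat_path by blast
  qed
  ultimately show "h \<circ> p \<in> dpaths (Sp Y)" by (simp add: Sp_def)
qed

lemma mpath_directed_piece: "\<gamma> \<in> G \<Longrightarrow> directed_piece G 0 1 \<gamma>"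
  unfolding directed_piece_def
  by (intro conjI bexI[of _ \<gamma>] exI[of _ "\<lambda>r. r"]) (auto intro!: mono_onI)

theorem theorem9p3:
  fixes X :: "'a mdspace" and Y :: "'b mdspace" and f :: "'a \<Rightarrow> 'b"
    and DX :: "'i::wellorder \<Rightarrow> 'c mdspace" and tX :: "'i \<Rightarrow> 'i \<Rightarrow> 'c \<Rightarrow> 'c"
    and cX :: "'i \<Rightarrow> 'c \<Rightarrow> 'a"
    and DY :: "'j::wellorder \<Rightarrow> 'd mdspace" and tY :: "'j \<Rightarrow> 'j \<Rightarrow> 'd \<Rightarrow> 'd"
    and cY :: "'j \<Rightarrow> 'd \<Rightarrow> 'b"
  assumes "is_mdspace X" and "is_mdspace Y"
    and "cellular_pres DX tX cX X" and "cellular_pres DY tY cY Y"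
    and "mdmap X Y f"
  shows "homeomorphic_map (mtop X) (mtop Y) f \<longleftrightarrow> dspace_iso (Sp X) (Sp Y) (f)"
proof
  assume "dspace_iso (Sp X) (Sp Y) f"
  \<comment> \<open>\<open>Sp\<close> keeps the underlying topology, so the inverse morphism is
    already a continuous inverse.\<close>
  then have "\<exists>g. homeomorphic_maps (mtop X) (mtop Y) f g"
    unfolding dspace_iso_def dmap_def homeomorphic_maps_def Sp_def by auto
  then show "homeomorphic_map (mtop X) (mtop Y) f"
    by (simp add: homeomorphic_map_maps)
next
  assume "homeomorphic_map (mtop X) (mtop Y) f"
  then obtain g where g: "continuous_map (mtop Y) (mtop X) g"
    and gf: "\<And>x. x \<in> topspace (mtop X) \<Longrightarrow> g (f x) = x"
    and fg: "\<And>y. y \<in> topspace (mtop Y) \<Longrightarrow> f (g y) = y"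
    unfolding homeomorphic_map_maps homeomorphic_maps_def by blast
  have g_top: "\<And>y. y \<in> topspace (mtop Y) \<Longrightarrow> g y \<in> topspace (mtop X)"
    using continuous_map_image_subset_topspace[OF g] by blast
  obtain E F where EF: "cell_path_system X E" "cell_path_system Y F"
    using assms(3,4)[THEN cellular_pres_imp_cell_path_system] by blast
  \<comment> \<open>An execution path of \<open>Y\<close> is cut into full traversals of paths in
    \<open>F\<close>, and these are pulled back one at a time.\<close>
  have "pieces (directed_piece (mpaths X)) 0 1 (g \<circ> \<gamma>)" if \<gamma>: "\<gamma> \<in> mpaths Y" for \<gamma>
  proof -
    have "pieces (full_piece F) 0 1 \<gamma>" using \<gamma> EF(2) unfolding cell_path_system_def by blast
    then show ?thesis
    proof (rule pieces_bind)
      fix a b p assume "full_piece F a b p"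
      then have "directed_piece F a b p" by (rule full_piece_imp_directed_piece)
      moreover have "pieces (directed_piece (mpaths X)) 0 1 (g \<circ> \<delta>)" if "\<delta> \<in> F" for \<delta>
        using cell_path_pullback[OF assms(1,2,5) EF g_top gf fg that] by (rule pieces.single)
      ultimately show "pieces (directed_piece (mpaths X)) a b (g \<circ> p)"
        using directed_pieces_transport by blast
    qed
  qed
  then have "dmap (Sp Y) (Sp X) g" using g by (rule dmap_SpI[rotated])
  moreover have "dmap (Sp X) (Sp Y) f"
    using assms(5) unfolding mdmap_def
    by (intro dmap_SpI pieces.single mpath_directed_piece) auto
  ultimately show "dspace_iso (Sp X) (Sp Y) f"
    unfolding dspace_iso_def using gf fg by (auto simp: Sp_def)
qed

end
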